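(* Let $u$ be the solution of the wave equation $\partial_t^2u(t,x)=L_xu(t,x)$, $u(0,x)=f(x)$, $\partial_t|_{t=0}u(t,x)=g(x)$, associated with the Dunkl-Cherednik Laplacian $L$ on $\mathfrak{a}$, with initial data $f,g\in\mathcal{C}_c^\infty(\mathfrak{a})$. Then the total energy $\mathcal{E}[u](t)=\mathcal{K}[u](t)+\mathcal{P}[u](t)$ is independent of $t\in\mathbb{R}$.
   Context: Setting: $\mathfrak{a}$ is a Euclidean vector space of dimension $d$ with inner product $\langle\cdot,\cdot\rangle$; $\mathcal{R}$ is a crystallographic root system in $\mathfrak{a}$ (not necessarily reduced), $\mathcal{R}^+$ a positive subsystem, $W$ the Weyl group generated by the reflections $r_\alpha(x)=x-2\frac{\langle\alpha,x\rangle}{\|\alpha\|^2}\alpha$, $\alpha\in\mathcal{R}$. A multiplicity function is a $W$-invariant function $k:\mathcal{R}\to[0,+\infty)$, $\alpha\mapsto k_\alpha$, and $\rho=\frac12\sum_{\alpha\in\mathcal{R}^+}k_\alpha\alpha$. The Dunkl-Cherednik operators are, for $\xi\in\mathfrak{a}$, $$T_\xi f(x)=\partial_\xi f(x)-\langle\rho,\xi\rangle f(x)+\sum_{\alpha\in\mathcal{R}^+}k_\alpha\frac{\langle\alpha,\xi\rangle}{1-e^{-\langle\alpha,x\rangle}}\{f(x)-f(r_\alpha x)\}.$$ Given an orthonormal basis $\{\xi_1,\dots,\xi_d\}$ of $\mathfrak{a}$, the Dunkl-Cherednik Laplacian is $L=\sum_{j=1}^dT_{\xi_j}^2$. Let $\mu(x)=\prod_{\alpha\in\mathcal{R}^+}|2\sinh\frac{\langle\alpha,x\rangle}2|^{2k_\alpha}$.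 $\mathcal{C}_c^\infty(\mathfrak{a})$ is the space of smooth compactly supported (complex-valued) functions on $\mathfrak{a}$. The solution $u(t,x)$ of the wave equation is the smooth solution with finite propagation speed: if $f,g$ vanish outside the ball $\|x\|\le R$, then $u(t,\cdot)$ is smooth and vanishes outside the ball $\|x\|\le R+|t|$. Energies: $$\mathcal{K}[u](t)=\tfrac12\int_{\mathfrak{a}}|\partial_tu(t,x)|^2\mu(x)\,dx,\qquad \mathcal{P}[u](t)=-\tfrac12\int_{\mathfrak{a}}L_xu(t,x)\,\overline{u(t,x)}\,\mu(x)\,dx,\qquad \mathcal{E}[u](t)=\mathcal{K}[u](t)+\mathcal{P}[u](t).$$ *)

theory Defs
  imports "HOL-Analysis.Analysis"
begin

primrec continuously_differentiable ::
    "nat \<Rightarrow> ('a::real_normed_vector \<Rightarrow> 'b::real_normed_vector) \<Rightarrow> bool" where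
  "continuously_differentiable 0 f \<longleftrightarrow> continuous_on UNIV f"
| "continuously_differentiable (Suc n) f \<longleftrightarrow>
     (\<forall>x. f differentiable (at x)) \<and>
     (\<forall>v. continuously_differentiable n (\<lambda>x. frechet_derivative f (at x) v))"

definition smooth :: "('a::real_normed_vector \<Rightarrow> 'b::real_normed_vector) \<Rightarrow> bool" where
  "smooth f \<longleftrightarrow> (\<forall>n. continuously_differentiable n f)"

definition test_function :: "('a::real_normed_vector \<Rightarrow> complex) \<Rightarrow> bool" where
  "test_function f \<longleftrightarrow> smooth f \<and> compact (closure {x. f x \<noteq> 0})"

definition refl_root :: "'a::real_inner \<Rightarrow> 'a \<Rightarrow> 'a" where
  "refl_root \<alpha> x = x - (2 * (\<alpha> \<bullet> x) / (norm \<alpha>)\<^sup>2) *\<^sub>R \<alpha>"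

(* The roots are not required to span the space, and R need not be reduced. *)
definition crystallographic_root_system :: "'a::real_inner set \<Rightarrow> bool" where
  "crystallographic_root_system R \<longleftrightarrow>
     finite R \<and> 0 \<notin> R \<and>
     (\<forall>\<alpha>\<in>R. refl_root \<alpha> ` R = R) \<and>
     (\<forall>\<alpha>\<in>R. \<forall>\<beta>\<in>R. 2 * (\<alpha> \<bullet> \<beta>) / (norm \<alpha>)\<^sup>2 \<in> \<int>)"

definition positive_subsystem :: "'a::real_inner set \<Rightarrow> 'a set \<Rightarrow> bool" where
  "positive_subsystem R P \<longleftrightarrow>
     (\<exists>v. (\<forall>\<alpha>\<in>R. \<alpha> \<bullet> v \<noteq> 0) \<and> P = {\<alpha>\<in>R. \<alpha> \<bullet> v > 0})"

(* Reflections are involutions, so closing the identity under composition with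
   them already yields the generated group. *)
inductive_set weyl_group :: "'a::real_inner set \<Rightarrow> ('a \<Rightarrow> 'a) set" for R where
  weyl_id: "id \<in> weyl_group R"
| weyl_refl: "w \<in> weyl_group R \<Longrightarrow> \<alpha> \<in> R \<Longrightarrow> refl_root \<alpha> \<circ> w \<in> weyl_group R"

(* Only the values of k on R are relevant. *)
definition multiplicity_function :: "'a::real_inner set \<Rightarrow> ('a \<Rightarrow> real) \<Rightarrow> bool" where
  "multiplicity_function R k \<longleftrightarrow>
     (\<forall>\<alpha>\<in>R. 0 \<le> k \<alpha>) \<and> (\<forall>w\<in>weyl_group R. \<forall>\<alpha>\<in>R. k (w \<alpha>) = k \<alpha>)"

definition rho :: "'a::real_inner set \<Rightarrow> ('a \<Rightarrow> real) \<Rightarrow> 'a" where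
  "rho P k = (1/2) *\<^sub>R (\<Sum>\<alpha>\<in>P. k \<alpha> *\<^sub>R \<alpha>)"

(* The quotient {f(x) - f(r x)} / (1 - exp(-<alpha,x>)) has, for smooth f, a removable
   singularity along the hyperplane <alpha,x> = 0: there
   f(x) - f(r x) ~ 2 <alpha,x> / |alpha|^2 * (derivative of f along alpha), while
   1 - exp(-<alpha,x>) ~ <alpha,x>.  The first branch is the value of the smooth
   extension; x / 0 = 0 would make the quotient discontinuous on the hyperplane. *)
definition root_quotient :: "'a::euclidean_space \<Rightarrow> ('a \<Rightarrow> complex) \<Rightarrow> 'a \<Rightarrow> complex" where
  "root_quotient \<alpha> f x =
     (if \<alpha> \<bullet> x = 0
      then of_real (2 / (norm \<alpha>)\<^sup>2) * frechet_derivative f (at x) \<alpha>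
      else (f x - f (refl_root \<alpha> x)) / of_real (1 - exp (- (\<alpha> \<bullet> x))))"

definition dunkl_cherednik ::
    "'a::euclidean_space set \<Rightarrow> ('a \<Rightarrow> real) \<Rightarrow> 'a \<Rightarrow> ('a \<Rightarrow> complex) \<Rightarrow> 'a \<Rightarrow> complex" where
  "dunkl_cherednik P k \<xi> f x =
     frechet_derivative f (at x) \<xi> - of_real (rho P k \<bullet> \<xi>) * f x
     + (\<Sum>\<alpha>\<in>P. of_real (k \<alpha> * (\<alpha> \<bullet> \<xi>)) * root_quotient \<alpha> f x)"

definition orthonormal_basis :: "'a::euclidean_space set \<Rightarrow> bool" where
  "orthonormal_basis B \<longleftrightarrow>
     pairwise orthogonal B \<and> (\<forall>b\<in>B. norm b = 1) \<and> span B = UNIV"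

definition dunkl_laplacian ::
    "'a::euclidean_space set \<Rightarrow> 'a set \<Rightarrow> ('a \<Rightarrow> real) \<Rightarrow> ('a \<Rightarrow> complex) \<Rightarrow> 'a \<Rightarrow> complex" where
  "dunkl_laplacian B P k f x =
     (\<Sum>\<xi>\<in>B. dunkl_cherednik P k \<xi> (dunkl_cherednik P k \<xi> f) x)"

(* As 0 powr 0 = 0, a root with k = 0 gives the factor 0 instead of 1 on its
   hyperplane; this is a Lebesgue null set. *)
definition weight :: "'a::euclidean_space set \<Rightarrow> ('a \<Rightarrow> real) \<Rightarrow> 'a \<Rightarrow> real" where
  "weight P k x = (\<Prod>\<alpha>\<in>P. \<bar>2 * sinh ((\<alpha> \<bullet> x) / 2)\<bar> powr (2 * k \<alpha>))"

definition time_deriv :: "(real \<Rightarrow> 'a \<Rightarrow> complex) \<Rightarrow> real \<Rightarrow> 'a \<Rightarrow> complex" where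
  "time_deriv u t x = vector_derivative (\<lambda>s. u s x) (at t)"

definition wave_solution ::
    "'a::euclidean_space set \<Rightarrow> 'a set \<Rightarrow> ('a \<Rightarrow> real) \<Rightarrow> ('a \<Rightarrow> complex) \<Rightarrow> ('a \<Rightarrow> complex)
      \<Rightarrow> (real \<Rightarrow> 'a \<Rightarrow> complex) \<Rightarrow> bool" where
  "wave_solution B P k f g u \<longleftrightarrow>
     smooth (\<lambda>(t, x). u t x) \<and>
     (\<forall>t x. time_deriv (time_deriv u) t x = dunkl_laplacian B P k (u t) x) \<and>
     (\<forall>x. u 0 x = f x) \<and>
     (\<forall>x. time_deriv u 0 x = g x) \<and>
     (\<forall>r\<ge>0. (\<forall>x. r < norm x \<longrightarrow> f x = 0 \<and> g x = 0) \<longrightarrow>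
            (\<forall>t x. r + \<bar>t\<bar> < norm x \<longrightarrow> u t x = 0))"

definition kinetic_energy ::
    "'a::euclidean_space set \<Rightarrow> ('a \<Rightarrow> real) \<Rightarrow> (real \<Rightarrow> 'a \<Rightarrow> complex) \<Rightarrow> real \<Rightarrow> real" where
  "kinetic_energy P k u t =
     1/2 * (\<integral>x. (cmod (time_deriv u t x))\<^sup>2 * weight P k x \<partial>lborel)"

definition potential_energy ::
    "'a::euclidean_space set \<Rightarrow> 'a set \<Rightarrow> ('a \<Rightarrow> real) \<Rightarrow> (real \<Rightarrow> 'a \<Rightarrow> complex)
      \<Rightarrow> real \<Rightarrow> complex" where
  "potential_energy B P k u t =
     - (1/2) * (\<integral>x. dunkl_laplacian B P k (u t) x * cnj (u t x) * of_real (weight P k x) \<partial>lborel)"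

definition total_energy ::
    "'a::euclidean_space set \<Rightarrow> 'a set \<Rightarrow> ('a \<Rightarrow> real) \<Rightarrow> (real \<Rightarrow> 'a \<Rightarrow> complex)
      \<Rightarrow> real \<Rightarrow> complex" where
  "total_energy B P k u t = of_real (kinetic_energy P k u t) + potential_energy B P k u t"

end

theory Submission
  imports Defs
begin

text \<open>Energy is conserved because \<open>L\<close> is symmetric for the measure with density \<open>weight P k\<close>.
  Given this, write \<open>\<langle>\<phi>, \<psi>\<rangle>\<close> for the weighted \<open>L\<^sup>2\<close> product. Symmetry and the wave equation give
  \<open>\<langle>u''(t), u(s)\<rangle> = \<langle>u(t), u''(s)\<rangle>\<close> for all times \<open>s\<close> and \<open>t\<close>, and differentiating this in \<open>s\<close> at \<open>s = t\<close>
  gives \<open>\<langle>u'', u'\<rangle> = \<langle>u, u'''\<rangle>\<close>. This is exactly what makes the derivative of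
  \<open>(\<langle>u', u'\<rangle> - \<langle>u'', u\<rangle>) / 2\<close> vanish (\<open>energy_constant\<close>). Using two times avoids differentiating
  \<open>L u\<close> in time; finite propagation speed makes all integrals run over a fixed box locally in time.

  For the symmetry, put \<open>c(s) = coth (s/2) / 2\<close>. Off the root hyperplanes the operator is
  \<open>T\<^sub>\<xi> = D\<^sub>\<xi> - S\<^sub>\<xi>\<close> with \<open>D\<^sub>\<xi> = \<partial>\<^sub>\<xi> + \<Sum> k\<^sub>\<alpha> \<langle>\<alpha>, \<xi>\<rangle> c(\<langle>\<alpha>, x\<rangle>) (1 - r\<^sub>\<alpha>)\<close> and
  \<open>S\<^sub>\<xi> = 1/2 \<Sum> k\<^sub>\<alpha> \<langle>\<alpha>, \<xi>\<rangle> r\<^sub>\<alpha>\<close>. Summed over an orthonormal basis, the mixed products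
  \<open>D S + S D\<close> cancel, because \<open>\<beta> \<mapsto> r\<^sub>\<alpha> \<beta>\<close> changes the sign of \<open>\<langle>\<alpha>, \<beta>\<rangle>\<close> (\<open>cross_terms_cancel\<close>). What
  remains (\<open>dunkl_laplacian_regular\<close>) is a second-order part, a part with \<open>c'\<close>, and double sums
  over roots. The bilinear form of each part is computed and is visibly symmetric
  (\<open>explicit_laplacian_form\<close>): the second-order part by partial integration, the others by the
  invariance of the measure under reflections, which symmetrizes an integral with an odd factor
  (\<open>W_integral_odd\<close>). For the double sum the adjoint of \<open>c (1 - r)\<close> produces
  an extra term, whose sum over all roots is again odd (\<open>coth_diff_form\<close>).

  Analytically, the weight is only continuous and \<open>c\<close> has a pole. After
  discarding the roots of multiplicity zero, the weight vanishes on every remaining hyperplane, and \<open>c\<close> times the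
  weight is locally integrable since it is a derivative of a continuous function along lines. So
  the fundamental theorem of calculus applies on each line, and averaging over translations
  transfers it to the whole space (\<open>integral_directional_derivative_eq_0\<close>).\<close>

section \<open>Reflections and translations of Lebesgue measure\<close>


lemma refl_root_involution: "a \<noteq> 0 \<Longrightarrow> refl_root a (refl_root a x) = x"
  by (simp add: refl_root_def inner_diff_right power2_norm_eq_inner)

lemma refl_root_adjoint: "refl_root a x \<bullet> y = x \<bullet> refl_root a y"
  by (simp add: refl_root_def inner_diff_right inner_diff_left inner_commute)

lemma inner_refl_root_refl_root: "a \<noteq> 0 \<Longrightarrow> refl_root a x \<bullet> refl_root a y = x \<bullet> y"
  by (simp add: refl_root_adjoint refl_root_involution)

lemma norm_refl_root: "a \<noteq> 0 \<Longrightarrow> norm (refl_root a x) = norm x"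
  by (simp add: norm_eq_sqrt_inner inner_refl_root_refl_root)

lemma linear_refl_root: "linear (refl_root a)"
  by (rule linearI) (simp_all add: refl_root_def inner_add_right scaleR_add_left add_divide_distrib algebra_simps)

lemmas refl_root_linear_simps [simp] =
  linear_0[OF linear_refl_root] linear_add[OF linear_refl_root] linear_diff[OF linear_refl_root]
  linear_neg[OF linear_refl_root] linear_scale[OF linear_refl_root]

lemma refl_root_self [simp]: "a \<noteq> 0 \<Longrightarrow> refl_root a a = - a"
  by (simp add: refl_root_def power2_norm_eq_inner flip: scaleR_diff_left) (simp add: scaleR_2)

lemma refl_root_minus_left [simp]: "refl_root (- a) x = refl_root a x"
  by (simp add: refl_root_def)

lemma refl_root_conjugate:
  "b \<noteq> 0 \<Longrightarrow> refl_root (refl_root b a) x = refl_root b (refl_root a (refl_root b x))"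
  by (simp add: refl_root_def[of "refl_root b a"] norm_refl_root)
     (simp add: refl_root_def[of a] refl_root_involution refl_root_adjoint)

lemma bounded_linear_refl_root: "bounded_linear (refl_root (a::'a::euclidean_space))"
  using linear_refl_root by (rule linear_conv_bounded_linear[THEN iffD1])

lemma continuous_on_refl_root [continuous_intros]:
  "continuous_on S f \<Longrightarrow> continuous_on S (\<lambda>x. refl_root (a::'a::euclidean_space) (f x))"
  by (rule bounded_linear.continuous_on[OF bounded_linear_refl_root])

lemma borel_measurable_refl_root [measurable]: "refl_root (a::'a::euclidean_space) \<in> borel_measurable borel"
  by (intro borel_measurable_continuous_onI continuous_intros)

lemma nn_integral_lborel_translate:
  fixes f :: "'a::euclidean_space \<Rightarrow> ennreal"
  assumes [measurable]: "f \<in> borel_measurable borel"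
  shows "(\<integral>\<^sup>+x. f (x + v) \<partial>lborel) = (\<integral>\<^sup>+x. f x \<partial>lborel)"
proof -
  have "(\<integral>\<^sup>+x. f x \<partial>lborel) = (\<integral>\<^sup>+x. f x \<partial>distr lborel borel ((+) v))"
    by (simp add: lborel_distr_plus)
  also have "\<dots> = (\<integral>\<^sup>+x. f (x + v) \<partial>lborel)"
    by (subst nn_integral_distr) (auto simp: add.commute)
  finally show ?thesis ..
qed

text \<open>A special case of the uniqueness of Haar measure. The image measure is translation invariant;
  integrating \<open>F(x) G(x + y)\<close> over both variables in the two possible orders shows that it is a
  multiple of Lebesgue measure. With the indicator of the unit ball as \<open>F\<close>, which is invariant under the reflection,
  the factor is 1.\<close>

lemma lborel_distr_refl_root:
  fixes a :: "'a::euclidean_space"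
  assumes "a \<noteq> 0"
  shows "distr lborel borel (refl_root a) = lborel"
proof (rule measure_eqI)
  let ?N = "distr lborel borel (refl_root a)"
  let ?r = "refl_root a"
  fix A :: "'a set" assume "A \<in> sets ?N"
  then have [measurable]: "A \<in> sets borel" by simp
  let ?F = "indicator (ball 0 1) :: 'a \<Rightarrow> ennreal"
  let ?G = "indicator A :: 'a \<Rightarrow> ennreal"
  have [measurable]: "?F \<in> borel_measurable borel" "?G \<in> borel_measurable borel"
    by (auto intro!: borel_measurable_indicator)
  have F_r: "?F (?r x) = ?F x" for x
    using assms by (auto simp: norm_refl_root indicator_def)
  have F_m: "?F (- x) = ?F x" for x
    by (auto simp: indicator_def)
  have I: "emeasure lborel (ball (0::'a) 1) = (\<integral>\<^sup>+x. ?F x \<partial>lborel)"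
    by simp
  have "(\<integral>\<^sup>+x. ?F x \<partial>lborel) * (\<integral>\<^sup>+y. ?G y \<partial>lborel)
      = (\<integral>\<^sup>+x. ?F (?r x) * (\<integral>\<^sup>+y. ?G y \<partial>lborel) \<partial>lborel)"
    by (subst nn_integral_multc) (auto simp: F_r)
  also have "\<dots> = (\<integral>\<^sup>+x. (\<integral>\<^sup>+y. ?F (?r x) * ?G (y + ?r x) \<partial>lborel) \<partial>lborel)"
    by (subst nn_integral_cmult) (auto simp: nn_integral_lborel_translate)
  also have "\<dots> = (\<integral>\<^sup>+y. (\<integral>\<^sup>+x. ?F (?r x) * ?G (y + ?r x) \<partial>lborel) \<partial>lborel)"
    by (rule lborel_pair.Fubini') measurable
  also have "\<dots> = (\<integral>\<^sup>+y. (\<integral>\<^sup>+x. ?F (?r x - y) * ?G (?r x) \<partial>lborel) \<partial>lborel)"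
  proof (rule nn_integral_cong)
    fix y :: 'a
    \<comment> \<open>Translating by the reflected vector moves \<open>y\<close> from \<open>G\<close> to \<open>F\<close>.\<close>
    have "(\<integral>\<^sup>+x. ?F (?r x) * ?G (y + ?r x) \<partial>lborel)
        = (\<integral>\<^sup>+x. ?F (?r (x + - ?r y)) * ?G (y + ?r (x + - ?r y)) \<partial>lborel)"
      by (rule nn_integral_lborel_translate[symmetric]) measurable
    then show "(\<integral>\<^sup>+x. ?F (?r x) * ?G (y + ?r x) \<partial>lborel) = (\<integral>\<^sup>+x. ?F (?r x - y) * ?G (?r x) \<partial>lborel)"
      using assms by (simp add: refl_root_involution)
  qed
  also have "\<dots> = (\<integral>\<^sup>+x. (\<integral>\<^sup>+y. ?F (?r x - y) * ?G (?r x) \<partial>lborel) \<partial>lborel)"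
    by (rule lborel_pair.Fubini'[symmetric]) measurable
  also have "\<dots> = (\<integral>\<^sup>+x. (\<integral>\<^sup>+y. ?F y \<partial>lborel) * ?G (?r x) \<partial>lborel)"
  proof (rule nn_integral_cong)
    fix x
    have "(\<integral>\<^sup>+y. ?F (?r x - y) \<partial>lborel) = (\<integral>\<^sup>+y. ?F (y + - ?r x) \<partial>lborel)"
      by (subst F_m[symmetric]) (simp add: algebra_simps)
    also have "\<dots> = (\<integral>\<^sup>+y. ?F y \<partial>lborel)"
      by (rule nn_integral_lborel_translate) measurable
    finally show "(\<integral>\<^sup>+y. ?F (?r x - y) * ?G (?r x) \<partial>lborel) = (\<integral>\<^sup>+y. ?F y \<partial>lborel) * ?G (?r x)"
      by (subst nn_integral_multc) auto
  qed
  also have "\<dots> = (\<integral>\<^sup>+y. ?F y \<partial>lborel) * (\<integral>\<^sup>+x. ?G (?r x) \<partial>lborel)"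
    by (subst nn_integral_cmult) auto
  finally have "emeasure lborel (ball (0::'a) 1) * (\<integral>\<^sup>+y. ?G y \<partial>lborel)
      = emeasure lborel (ball (0::'a) 1) * (\<integral>\<^sup>+x. ?G (?r x) \<partial>lborel)"
    by (simp only: I)
  moreover have "emeasure lborel (ball (0::'a) 1) < \<infinity>"
    by (rule emeasure_bounded_finite) simp
  moreover have "emeasure lborel (ball (0::'a) 1) \<noteq> 0"
    using open_not_negligible[of "ball (0::'a) 1"] by (auto simp: negligible_iff_emeasure0)
  ultimately have "(\<integral>\<^sup>+y. ?G y \<partial>lborel) = (\<integral>\<^sup>+x. ?G (?r x) \<partial>lborel)"
    by (auto simp: ennreal_mult_cancel_left)
  also have "\<dots> = (\<integral>\<^sup>+x. ?G x \<partial>?N)"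
    by (subst nn_integral_distr) auto
  finally show "emeasure ?N A = emeasure lborel A"
    by simp
qed simp

lemma integral_lborel_refl_root:
  fixes f :: "'a::euclidean_space \<Rightarrow> 'b::{banach,second_countable_topology}"
  assumes "a \<noteq> 0" and [measurable]: "f \<in> borel_measurable borel"
  shows "(\<integral>x. f (refl_root a x) \<partial>lborel) = (\<integral>x. f x \<partial>lborel)"
proof -
  have "(\<integral>x. f x \<partial>lborel) = (\<integral>x. f x \<partial>distr lborel borel (refl_root a))"
    using assms by (simp add: lborel_distr_refl_root)
  also have "\<dots> = (\<integral>x. f (refl_root a x) \<partial>lborel)"
    by (subst integral_distr) auto
  finally show ?thesis ..
qed

lemma nn_integral_lborel_translation_average:
  fixes f :: "'a::euclidean_space \<Rightarrow> ennreal" and v :: 'a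
  assumes [measurable]: "f \<in> borel_measurable borel"
  shows "(\<integral>\<^sup>+x. (\<integral>\<^sup>+\<tau>. f (x + \<tau> *\<^sub>R v) * indicator {0..1::real} \<tau> \<partial>lborel) \<partial>lborel) = (\<integral>\<^sup>+x. f x \<partial>lborel)"
proof -
  have "(\<integral>\<^sup>+x. (\<integral>\<^sup>+\<tau>. f (x + \<tau> *\<^sub>R v) * indicator {0..1::real} \<tau> \<partial>lborel) \<partial>lborel)
     = (\<integral>\<^sup>+\<tau>. (\<integral>\<^sup>+x. f (x + \<tau> *\<^sub>R v) * indicator {0..1::real} \<tau> \<partial>lborel) \<partial>lborel)"
    by (rule lborel_pair.Fubini') measurable
  also have "\<dots> = (\<integral>\<^sup>+\<tau>. (\<integral>\<^sup>+x. f x \<partial>lborel) * indicator {0..1::real} \<tau> \<partial>lborel)"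
    by (subst nn_integral_multc) (auto simp: nn_integral_lborel_translate)
  also have "\<dots> = (\<integral>\<^sup>+x. f x \<partial>lborel)"
    by (subst nn_integral_cmult) auto
  finally show ?thesis .
qed

text \<open>Translation invariance replaces a choice of coordinates: averaging over the translates
  by \<open>\<tau> v\<close>, \<open>0 \<le> \<tau> \<le> 1\<close>, reduces the claim to the fundamental theorem of calculus on each line.\<close>

lemma integral_directional_derivative_eq_0:
  fixes F G :: "'a::euclidean_space \<Rightarrow> 'b::euclidean_space"
  assumes F: "integrable lborel F" and G: "integrable lborel G"
    and FTC: "\<And>x. ((\<lambda>\<tau>. G (x + \<tau> *\<^sub>R v)) has_integral F (x + v) - F x) {0..1}"
  shows "(\<integral>x. G x \<partial>lborel) = 0"
proof -
  have [measurable]: "F \<in> borel_measurable borel" "G \<in> borel_measurable borel"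
    using F G by (auto dest: borel_measurable_integrable)
  let ?H = "\<lambda>(x, \<tau>). indicator {0..1::real} \<tau> *\<^sub>R G (x + \<tau> *\<^sub>R v)"
  have int: "integrable (lborel \<Otimes>\<^sub>M lborel) ?H"
  proof (rule integrableI_bounded)
    have "(\<integral>\<^sup>+p. norm (?H p) \<partial>(lborel \<Otimes>\<^sub>M lborel))
      = (\<integral>\<^sup>+x. (\<integral>\<^sup>+\<tau>. norm (?H (x, \<tau>)) \<partial>lborel) \<partial>lborel)"
      by (rule lborel.nn_integral_fst[symmetric]) measurable
    also have "\<dots> = (\<integral>\<^sup>+x. (\<integral>\<^sup>+\<tau>. ennreal (norm (G (x + \<tau> *\<^sub>R v))) * indicator {0..1::real} \<tau> \<partial>lborel) \<partial>lborel)"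
      by (intro nn_integral_cong) (auto simp: indicator_def)
    also have "\<dots> = (\<integral>\<^sup>+x. norm (G x) \<partial>lborel)"
      by (rule nn_integral_lborel_translation_average) measurable
    also have "\<dots> < \<infinity>"
      using G by (simp add: integrable_iff_bounded)
    finally show "(\<integral>\<^sup>+p. norm (?H p) \<partial>(lborel \<Otimes>\<^sub>M lborel)) < \<infinity>" .
  qed measurable
  have translate: "(\<integral>x. f (x + c) \<partial>lborel) = (\<integral>x. f x \<partial>lborel)"
    "integrable lborel f \<Longrightarrow> integrable lborel (\<lambda>x. f (x + c))"
    if [measurable]: "f \<in> borel_measurable borel" for f :: "'a \<Rightarrow> 'b" and c
  proof -
    have "(\<integral>x. f x \<partial>lborel) = (\<integral>x. f x \<partial>distr lborel borel ((+) c))"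
      by (simp add: lborel_distr_plus)
    also have "\<dots> = (\<integral>x. f (x + c) \<partial>lborel)"
      by (subst integral_distr) (auto simp: add.commute)
    finally show "(\<integral>x. f (x + c) \<partial>lborel) = (\<integral>x. f x \<partial>lborel)" ..
    show "integrable lborel (\<lambda>x. f (x + c))" if "integrable lborel f"
    proof -
      have "integrable (distr lborel borel ((+) c)) f"
        using that by (simp add: lborel_distr_plus)
      then show ?thesis
        by (subst (asm) integrable_distr_eq) (auto simp: add.commute)
    qed
  qed
  have "(\<integral>x. G x \<partial>lborel) = (\<integral>\<tau>. indicator {0..1::real} \<tau> *\<^sub>R (\<integral>x. G x \<partial>lborel) \<partial>lborel)"
    by simp
  also have "\<dots> = (\<integral>\<tau>. (\<integral>x. ?H (x, \<tau>) \<partial>lborel) \<partial>lborel)"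
    by (simp add: translate(1))
  also have "\<dots> = (\<integral>x. (\<integral>\<tau>. ?H (x, \<tau>) \<partial>lborel) \<partial>lborel)"
    using lborel_pair.Fubini_integral[of "\<lambda>x \<tau>. ?H (x, \<tau>)"] int by simp
  also have "\<dots> = (\<integral>x. F (x + v) - F x \<partial>lborel)"
  proof (rule integral_cong_AE)
    show "AE x in lborel. (\<integral>\<tau>. ?H (x, \<tau>) \<partial>lborel) = F (x + v) - F x"
      using lborel_pair.AE_integrable_fst'[OF int]
    proof eventually_elim
      case (elim x)
      then have "set_integrable lborel {0..1} (\<lambda>\<tau>. G (x + \<tau> *\<^sub>R v))"
        by (simp add: set_integrable_def)
      from set_borel_integral_eq_integral(2)[OF this] FTC[of x]
      show ?case
        by (simp add: set_lebesgue_integral_def integral_unique)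
    qed
    show "(\<lambda>x. \<integral>\<tau>. ?H (x, \<tau>) \<partial>lborel) \<in> borel_measurable lborel"
      by (rule lborel.borel_measurable_lebesgue_integral) measurable
  qed measurable
  also have "\<dots> = 0"
    using F by (simp add: translate)
  finally show ?thesis .
qed


section \<open>The singular coefficient\<close>

text \<open>The coefficient \<open>coth (s/2) / 2\<close>, that is, the odd part of \<open>1 / (1 - exp (- s))\<close>. Because of
  \<open>x / 0 = 0\<close> its value at the pole is 0, which keeps the function odd everywhere.\<close>

definition half_coth :: "real \<Rightarrow> real" where
  "half_coth s = cosh (s / 2) / (2 * sinh (s / 2))"

definition half_coth_deriv :: "real \<Rightarrow> real" where
  "half_coth_deriv s = - 1 / (4 * (sinh (s / 2))\<^sup>2)"

lemma half_coth_minus [simp]: "half_coth (- s) = - half_coth s"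
  by (simp add: half_coth_def)

lemma half_coth_deriv_minus [simp]: "half_coth_deriv (- s) = half_coth_deriv s"
  by (simp add: half_coth_deriv_def)

lemma inverse_one_minus_exp: "s \<noteq> 0 \<Longrightarrow> 1 / (1 - exp (- s)) = 1 / 2 + half_coth s"
proof -
  assume s: "s \<noteq> 0"
  define e where "e = exp (s / 2)"
  have e: "e > 0" by (simp add: e_def)
  have "e \<noteq> 1" using s by (simp add: e_def)
  then have "e * e \<noteq> 1" using e
    by (metis abs_of_pos abs_square_eq_1 power2_eq_square)
  have "half_coth s = ((e + inverse e) / 2) / (2 * ((e - inverse e) / 2))"
    by (simp add: half_coth_def sinh_field_def cosh_field_def e_def exp_minus)
  moreover have "exp (- s) = inverse (e * e)"
    by (simp add: e_def exp_minus flip: exp_add)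
  moreover have "e + inverse e = (e * e + 1) / e" "e - inverse e = (e * e - 1) / e"
    "1 - inverse (e * e) = (e * e - 1) / (e * e)"
    using e by (simp_all add: field_simps)
  ultimately have h: "half_coth s = (e * e + 1) / (2 * (e * e - 1))"
    and x: "1 - exp (- s) = (e * e - 1) / (e * e)"
    using e by simp_all
  show ?thesis
    unfolding h x using e \<open>e * e \<noteq> 1\<close> by (simp add: divide_simps)
qed

lemma half_coth_has_derivative:
  assumes "s \<noteq> 0" shows "(half_coth has_real_derivative half_coth_deriv s) (at s)"
proof -
  have "((\<lambda>s. cosh (s / 2)) has_real_derivative sinh (s / 2) / 2) (at s)"
    "((\<lambda>s. 2 * sinh (s / 2)) has_real_derivative cosh (s / 2)) (at s)"
    by (auto intro!: derivative_eq_intros)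
  from DERIV_divide[OF this] assms
  have "(half_coth has_real_derivative (sinh (s / 2) / 2 * (2 * sinh (s / 2)) - cosh (s / 2) * cosh (s / 2))
      / (2 * sinh (s / 2) * (2 * sinh (s / 2)))) (at s)"
    by (simp add: half_coth_def[abs_def])
  moreover have "sinh (s / 2) / 2 * (2 * sinh (s / 2)) - cosh (s / 2) * cosh (s / 2) = - 1"
    using hyperbolic_pythagoras[of "s / 2"] by (simp add: power2_eq_square)
  ultimately show ?thesis
    by (simp add: half_coth_deriv_def power2_eq_square)
qed

lemma abs_le_abs_sinh: "\<bar>y\<bar> \<le> \<bar>sinh y\<bar>" for y :: real
  using real_le_abs_sinh[of y] by (simp add: sinh_field_def exp_minus)

text \<open>The pole is of first order, so it is absorbed by a factor \<open>f x - f (refl_root a x)\<close>, which is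
  of the size of \<open>a \<bullet> x\<close>. The next bound says that such a factor lowers the second-order pole of
  the derivative to a pole of first order.\<close>

lemma abs_half_coth_mult_le: "\<bar>half_coth s * s\<bar> \<le> cosh (s / 2)"
proof (cases "s = 0")
  case False
  have "\<bar>s\<bar> \<le> \<bar>2 * sinh (s / 2)\<bar>"
    using abs_le_abs_sinh[of "s / 2"] by simp
  then have "cosh (s / 2) * \<bar>s\<bar> \<le> cosh (s / 2) * \<bar>2 * sinh (s / 2)\<bar>"
    by (intro mult_left_mono) auto
  with False show ?thesis
    by (simp add: half_coth_def abs_mult divide_simps)
qed simp

lemma abs_half_coth_deriv_mult_le: "\<bar>half_coth_deriv s * s\<bar> \<le> \<bar>half_coth s\<bar>"
proof (cases "s = 0")
  case False
  have "\<bar>s\<bar> \<le> \<bar>2 * sinh (s / 2)\<bar>"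
    using abs_le_abs_sinh[of "s / 2"] by simp
  also have "\<dots> \<le> \<bar>2 * sinh (s / 2)\<bar> * cosh (s / 2)"
    using mult_left_mono[OF cosh_real_ge_1[of "s / 2"], of "\<bar>2 * sinh (s / 2)\<bar>"] by simp
  finally have le: "\<bar>s\<bar> \<le> 2 * \<bar>sinh (s / 2)\<bar> * cosh (s / 2)"
    by (simp add: abs_mult)
  define S where "S = \<bar>sinh (s / 2)\<bar>"
  have "S > 0" using False by (simp add: S_def)
  have "\<bar>half_coth_deriv s * s\<bar> = \<bar>s\<bar> / (4 * (S * S))" "\<bar>half_coth s\<bar> = cosh (s / 2) / (2 * S)"
    by (simp_all add: S_def half_coth_def half_coth_deriv_def abs_mult power2_eq_square)
  moreover have "\<bar>s\<bar> / (4 * (S * S)) \<le> (2 * S * cosh (s / 2)) / (4 * (S * S))"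
    using le \<open>S > 0\<close> unfolding S_def[symmetric] by (intro divide_right_mono) auto
  ultimately show ?thesis
    using \<open>S > 0\<close> by simp
qed simp

lemma borel_measurable_half_coth [measurable]:
  "half_coth \<in> borel_measurable borel" "half_coth_deriv \<in> borel_measurable borel"
proof -
  have [measurable]: "(sinh::real\<Rightarrow>real) \<in> borel_measurable borel" "(cosh::real\<Rightarrow>real) \<in> borel_measurable borel"
    by (intro borel_measurable_continuous_onI continuous_intros)+
  show "half_coth \<in> borel_measurable borel" "half_coth_deriv \<in> borel_measurable borel"
    unfolding half_coth_def[abs_def] half_coth_deriv_def[abs_def] by measurable
qed

definition root_weight :: "real \<Rightarrow> real \<Rightarrow> real" where
  "root_weight p s = \<bar>2 * sinh (s / 2)\<bar> powr p"

lemma root_weight_nonneg [simp]: "root_weight p s \<ge> 0"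
  by (simp add: root_weight_def)

lemma root_weight_0 [simp]: "root_weight p 0 = 0"
  by (simp add: root_weight_def)

lemma root_weight_minus [simp]: "root_weight p (- s) = root_weight p s"
  by (simp add: root_weight_def)

lemma continuous_on_root_weight [continuous_intros]:
  assumes "p > 0" "continuous_on S f" shows "continuous_on S (\<lambda>x. root_weight p (f x))"
  unfolding root_weight_def
  by (rule continuous_on_powr') (use assms in \<open>auto intro!: continuous_intros\<close>)

lemma root_weight_has_derivative:
  assumes "s \<noteq> 0"
  shows "(root_weight p has_real_derivative p * half_coth s * root_weight p s) (at s)"
proof -
  have eq: "root_weight p = (\<lambda>s. (4 * (sinh (s / 2))\<^sup>2) powr (p / 2))"
  proof
    fix s :: real
    have "4 * (sinh (s / 2))\<^sup>2 = \<bar>2 * sinh (s / 2)\<bar> powr 2"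
      by (simp add: power2_eq_square)
    then show "root_weight p s = (4 * (sinh (s / 2))\<^sup>2) powr (p / 2)"
      by (simp only: powr_powr) (simp add: root_weight_def)
  qed
  have pos: "4 * (sinh (s / 2))\<^sup>2 > 0" using assms by simp
  have d: "((\<lambda>s. 4 * (sinh (s / 2))\<^sup>2) has_real_derivative 4 * sinh (s / 2) * cosh (s / 2)) (at s)"
    by (auto intro!: derivative_eq_intros)
  have "4 * sinh (s / 2) * cosh (s / 2) * (p / 2) / (4 * (sinh (s / 2))\<^sup>2) = p * half_coth s"
    using assms by (simp add: half_coth_def power2_eq_square)
  then show ?thesis
    unfolding eq
    by (intro DERIV_cong[OF DERIV_powr[OF d pos DERIV_const]]) simp
qed

text \<open>Although \<open>half_coth\<close> has a pole at the origin, \<open>\<bar>half_coth s\<bar> * root_weight p s\<close> is the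
  derivative of the continuous function below, so it is locally integrable for every \<open>p > 0\<close>.\<close>

definition signed_root_weight :: "real \<Rightarrow> real \<Rightarrow> real" where
  "signed_root_weight p s = (if s \<ge> 0 then root_weight p s else - root_weight p s) / p"

lemma continuous_on_signed_root_weight:
  assumes "p > 0" shows "continuous_on UNIV (signed_root_weight p)"
proof -
  have "continuous_on ({0..} \<union> {..0}) (\<lambda>s. if s \<ge> 0 then root_weight p s else - root_weight p s)"
    by (rule continuous_on_cases) (use assms in \<open>auto intro!: continuous_intros\<close>)
  moreover have "{0..} \<union> {..0} = (UNIV :: real set)" by auto
  ultimately show ?thesis
    unfolding signed_root_weight_def[abs_def] using assms by (auto intro!: continuous_intros)
qed

lemma signed_root_weight_has_derivative:
  assumes "p > 0" "s \<noteq> 0"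
  shows "(signed_root_weight p has_real_derivative \<bar>half_coth s\<bar> * root_weight p s) (at s)"
proof (cases "s > 0")
  case True
  have "((\<lambda>s. root_weight p s / p) has_real_derivative (p * half_coth s * root_weight p s) / p) (at s)"
    using root_weight_has_derivative[OF assms(2), of p] by (rule DERIV_cdivide)
  moreover have "half_coth s > 0" using True by (simp add: half_coth_def)
  ultimately have "((\<lambda>s. root_weight p s / p) has_real_derivative \<bar>half_coth s\<bar> * root_weight p s) (at s)"
    using assms by simp
  then show ?thesis
    by (rule has_field_derivative_transform_within_open[where S="{0<..}"])
       (use True in \<open>auto simp: signed_root_weight_def\<close>)
next
  case False
  then have "s < 0" using assms by simp
  have "((\<lambda>s. - root_weight p s / p) has_real_derivative (- (p * half_coth s * root_weight p s)) / p) (at s)"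
    using DERIV_minus[OF root_weight_has_derivative[OF assms(2), of p]] by (rule DERIV_cdivide)
  moreover have "half_coth s < 0" using \<open>s < 0\<close> by (simp add: half_coth_def divide_simps)
  ultimately have "((\<lambda>s. - root_weight p s / p) has_real_derivative \<bar>half_coth s\<bar> * root_weight p s) (at s)"
    using assms by simp
  then show ?thesis
    by (rule has_field_derivative_transform_within_open[where S="{..<0}"])
       (use \<open>s < 0\<close> in \<open>auto simp: signed_root_weight_def\<close>)
qed

text \<open>Averaging over the translates in the direction \<open>a\<close> turns the integrand into a difference
  quotient of \<open>signed_root_weight\<close>, which is bounded on bounded sets.\<close>

lemma nn_integral_half_coth_root_weight_cball:
  fixes a :: "'a::euclidean_space"
  assumes a: "a \<noteq> 0" and p: "p > 0"
  shows "(\<integral>\<^sup>+x. ennreal (\<bar>half_coth (a \<bullet> x)\<bar> * root_weight p (a \<bullet> x)) * indicator (cball 0 r) x \<partial>lborel) < \<infinity>"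
proof -
  let ?\<psi> = "\<lambda>s. \<bar>half_coth s\<bar> * root_weight p s"
  let ?\<phi> = "signed_root_weight p"
  have [measurable]: "root_weight p \<in> borel_measurable borel"
    by (intro borel_measurable_continuous_onI continuous_intros p)
  have [measurable]: "cball (0::'a) R \<in> sets borel" for R
    by simp
  let ?I = "\<lambda>x. (?\<phi> (a \<bullet> x + a \<bullet> a) - ?\<phi> (a \<bullet> x)) / (a \<bullet> a)"
  have cont: "continuous_on (cball 0 (r + norm a)) ?I"
    using a by (intro continuous_intros continuous_on_compose2[OF continuous_on_signed_root_weight[OF p]]) auto
  then have "bounded (?I ` cball 0 (r + norm a))"
    by (intro compact_imp_bounded compact_continuous_image) auto
  then obtain C where "\<forall>y\<in>?I ` cball 0 (r + norm a). norm y \<le> C"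
    unfolding bounded_iff by blast
  then have C: "\<bar>?I x\<bar> \<le> C" if "x \<in> cball 0 (r + norm a)" for x
    using that by simp
  have line: "(\<integral>\<^sup>+\<tau>. ennreal (?\<psi> (a \<bullet> (x + \<tau> *\<^sub>R a))) * indicator {0..1::real} \<tau> \<partial>lborel) = ennreal (?I x)" for x
  proof -
    have "((\<lambda>\<tau>. ?\<psi> (a \<bullet> (x + \<tau> *\<^sub>R a))) has_integral
        ?\<phi> (a \<bullet> x + 1 * (a \<bullet> a)) / (a \<bullet> a) - ?\<phi> (a \<bullet> x + 0 * (a \<bullet> a)) / (a \<bullet> a)) {0..1}"
    proof (rule fundamental_theorem_of_calculus_interior_strong[of "{- (a \<bullet> x) / (a \<bullet> a)}"
          _ _ "\<lambda>\<tau>. ?\<phi> (a \<bullet> x + \<tau> * (a \<bullet> a)) / (a \<bullet> a)"])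
      fix \<tau> assume "\<tau> \<in> {0<..<1} - {- (a \<bullet> x) / (a \<bullet> a)}"
      then have "\<tau> \<noteq> - (a \<bullet> x) / (a \<bullet> a)" by simp
      then have "\<tau> * (a \<bullet> a) \<noteq> - (a \<bullet> x)"
        using a by (metis inner_eq_zero_iff nonzero_eq_divide_eq)
      then have nz: "a \<bullet> x + \<tau> * (a \<bullet> a) \<noteq> 0"
        by linarith
      have "((\<lambda>\<tau>. a \<bullet> x + \<tau> * (a \<bullet> a)) has_real_derivative a \<bullet> a) (at \<tau>)"
        by (auto intro!: derivative_eq_intros)
      from DERIV_chain2[OF signed_root_weight_has_derivative[OF p nz] this]
      have "((\<lambda>\<tau>. ?\<phi> (a \<bullet> x + \<tau> * (a \<bullet> a)) / (a \<bullet> a)) has_real_derivative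
          (?\<psi> (a \<bullet> x + \<tau> * (a \<bullet> a)) * (a \<bullet> a)) / (a \<bullet> a)) (at \<tau>)"
        by (rule DERIV_cdivide)
      then show "((\<lambda>\<tau>. ?\<phi> (a \<bullet> x + \<tau> * (a \<bullet> a)) / (a \<bullet> a)) has_vector_derivative
          ?\<psi> (a \<bullet> (x + \<tau> *\<^sub>R a))) (at \<tau>)"
        using a by (simp add: has_real_derivative_iff_has_vector_derivative inner_add_right)
    qed (use a in \<open>auto intro!: continuous_intros continuous_on_compose2[OF continuous_on_signed_root_weight[OF p]]\<close>)
    then have "((\<lambda>\<tau>. ?\<psi> (a \<bullet> (x + \<tau> *\<^sub>R a))) has_integral ?I x) {0..1}"
      by (simp add: diff_divide_distrib)
    then have "((\<lambda>\<tau>. if \<tau> \<in> {0..1} then ?\<psi> (a \<bullet> (x + \<tau> *\<^sub>R a)) else 0) has_integral ?I x) UNIV"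
      by (simp only: has_integral_restrict_UNIV)
    then have "(\<integral>\<^sup>+\<tau>. ennreal (if \<tau> \<in> {0..1} then ?\<psi> (a \<bullet> (x + \<tau> *\<^sub>R a)) else 0) \<partial>lborel) = ennreal (?I x)"
      by (intro nn_integral_has_integral_lborel) auto
    also have "(\<integral>\<^sup>+\<tau>. ennreal (if \<tau> \<in> {0..1} then ?\<psi> (a \<bullet> (x + \<tau> *\<^sub>R a)) else 0) \<partial>lborel)
       = (\<integral>\<^sup>+\<tau>. ennreal (?\<psi> (a \<bullet> (x + \<tau> *\<^sub>R a))) * indicator {0..1::real} \<tau> \<partial>lborel)"
      by (intro nn_integral_cong) (auto simp: indicator_def)
    finally show ?thesis .
  qed
  have "(\<integral>\<^sup>+x. ennreal (?\<psi> (a \<bullet> x)) * indicator (cball 0 r) x \<partial>lborel)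
      = (\<integral>\<^sup>+x. (\<integral>\<^sup>+\<tau>. (ennreal (?\<psi> (a \<bullet> (x + \<tau> *\<^sub>R a))) * indicator (cball 0 r) (x + \<tau> *\<^sub>R a))
          * indicator {0..1::real} \<tau> \<partial>lborel) \<partial>lborel)"
    by (rule nn_integral_lborel_translation_average[symmetric]) measurable
  also have "\<dots> \<le> (\<integral>\<^sup>+x. ennreal C * indicator (cball (0::'a) (r + norm a)) x \<partial>lborel)"
  proof (rule nn_integral_mono)
    fix x :: 'a
    have "(\<integral>\<^sup>+\<tau>. (ennreal (?\<psi> (a \<bullet> (x + \<tau> *\<^sub>R a))) * indicator (cball 0 r) (x + \<tau> *\<^sub>R a))
          * indicator {0..1::real} \<tau> \<partial>lborel)
      \<le> (\<integral>\<^sup>+\<tau>. (ennreal (?\<psi> (a \<bullet> (x + \<tau> *\<^sub>R a))) * indicator {0..1::real} \<tau>)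
          * indicator (cball 0 (r + norm a)) x \<partial>lborel)"
    proof (rule nn_integral_mono)
      fix \<tau> :: real
      have "norm x \<le> r + norm a" if "\<tau> \<in> {0..1}" "norm (x + \<tau> *\<^sub>R a) \<le> r"
      proof -
        have "norm x \<le> norm (x + \<tau> *\<^sub>R a) + norm (\<tau> *\<^sub>R a)"
          by (metis add_diff_cancel norm_triangle_ineq4)
        also have "norm (\<tau> *\<^sub>R a) \<le> norm a"
          using that by (simp add: mult_left_le_one_le)
        finally show ?thesis using that by simp
      qed
      then have "indicator (cball 0 r) (x + \<tau> *\<^sub>R a) * indicator {0..1::real} \<tau>
        \<le> (indicator {0..1::real} \<tau> * indicator (cball 0 (r + norm a)) x :: ennreal)"
        by (auto simp: indicator_def)
      then show "(ennreal (?\<psi> (a \<bullet> (x + \<tau> *\<^sub>R a))) * indicator (cball 0 r) (x + \<tau> *\<^sub>R a))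
          * indicator {0..1::real} \<tau>
        \<le> (ennreal (?\<psi> (a \<bullet> (x + \<tau> *\<^sub>R a))) * indicator {0..1::real} \<tau>) * indicator (cball 0 (r + norm a)) x"
        unfolding mult.assoc by (rule mult_left_mono) simp
    qed
    also have "\<dots> = ennreal (?I x) * indicator (cball 0 (r + norm a)) x"
      by (subst nn_integral_multc) (measurable, simp only: line)
    also have "\<dots> \<le> ennreal C * indicator (cball 0 (r + norm a)) x"
    proof (cases "x \<in> cball 0 (r + norm a)")
      case True
      from C[OF True] have "?I x \<le> C" by linarith
      then show ?thesis by (intro mult_right_mono ennreal_leI) auto
    qed simp
    finally show "(\<integral>\<^sup>+\<tau>. (ennreal (?\<psi> (a \<bullet> (x + \<tau> *\<^sub>R a))) * indicator (cball 0 r) (x + \<tau> *\<^sub>R a))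
          * indicator {0..1::real} \<tau> \<partial>lborel) \<le> ennreal C * indicator (cball 0 (r + norm a)) x" .
  qed
  also have "\<dots> = ennreal C * emeasure lborel (cball (0::'a) (r + norm a))"
    by (subst nn_integral_cmult_indicator) auto
  also have "\<dots> < \<infinity>"
    using emeasure_bounded_finite[of "cball (0::'a) (r + norm a)"] by (simp add: ennreal_mult_less_top)
  finally show ?thesis .
qed


section \<open>Bounded functions of bounded support\<close>

definition bounded_supp :: "('a::euclidean_space \<Rightarrow> complex) \<Rightarrow> bool" where
  "bounded_supp h \<longleftrightarrow> h \<in> borel_measurable borel \<and>
     (\<exists>M r. \<forall>x. norm (h x) \<le> M \<and> (r < norm x \<longrightarrow> h x = 0))"

lemma bounded_suppI:
  assumes "h \<in> borel_measurable borel" "\<And>x. norm (h x) \<le> M" "\<And>x. r < norm x \<Longrightarrow> h x = 0"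
  shows "bounded_supp h"
  using assms by (auto simp: bounded_supp_def)

lemma bounded_supp_measurable [measurable_dest]: "bounded_supp h \<Longrightarrow> h \<in> borel_measurable borel"
  by (simp add: bounded_supp_def)

lemma bounded_suppE:
  assumes "bounded_supp h"
  obtains M r where "M \<ge> 0" "\<And>x. norm (h x) \<le> M" "\<And>x. r < norm x \<Longrightarrow> h x = 0"
proof -
  from assms obtain M r where *: "\<And>x. norm (h x) \<le> M" "\<And>x. r < norm x \<Longrightarrow> h x = 0"
    by (auto simp: bounded_supp_def)
  moreover have "M \<ge> 0" using *(1)[of 0] norm_ge_zero[of "h 0"] by linarith
  ultimately show ?thesis using that by blast
qed

lemma bounded_supp_continuous:
  assumes cont: "continuous_on UNIV h" and supp: "\<And>x. r < norm x \<Longrightarrow> h x = 0"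
  shows "bounded_supp h"
proof -
  have "bounded (h ` cball 0 r)"
    by (intro compact_imp_bounded compact_continuous_image continuous_on_subset[OF cont]) auto
  then obtain M where "\<forall>y\<in>h ` cball 0 r. norm y \<le> M"
    unfolding bounded_iff by blast
  then have M: "norm (h x) \<le> M" if "norm x \<le> r" for x
    using that by simp
  show ?thesis
  proof (rule bounded_suppI[where r=r and M="max M 0"])
    show "norm (h x) \<le> max M 0" for x
      using M[of x] supp[of x] by (cases "norm x \<le> r") auto
  qed (use assms in \<open>auto intro: borel_measurable_continuous_onI\<close>)
qed

lemma bounded_supp_mult:
  assumes f: "bounded_supp f" and [measurable]: "g \<in> borel_measurable borel"
    and g: "\<And>x r. norm x \<le> r \<Longrightarrow> norm (g x) \<le> N r"
  shows "bounded_supp (\<lambda>x. f x * g x)"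
proof -
  note [measurable] = f[THEN bounded_supp_measurable]
  from f obtain M r where f: "M \<ge> 0" "\<And>x. norm (f x) \<le> M" "\<And>x. r < norm x \<Longrightarrow> f x = 0"
    by (rule bounded_suppE) blast
  show ?thesis
  proof (rule bounded_suppI[where M="M * max 0 (N r)" and r=r])
    show "norm (f x * g x) \<le> M * max 0 (N r)" for x
    proof (cases "norm x \<le> r")
      case True
      then show ?thesis
        unfolding norm_mult using g[of x r] f by (intro mult_mono) auto
    qed (use f in auto)
  qed (use f in auto)
qed

lemma bounded_supp_times [intro]:
  assumes "bounded_supp f" "bounded_supp g" shows "bounded_supp (\<lambda>x. f x * g x)"
proof -
  from assms(2) obtain N s where g: "N \<ge> 0" "\<And>x. norm (g x) \<le> N" "\<And>x. s < norm x \<Longrightarrow> g x = 0"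
    by (rule bounded_suppE) blast
  then show ?thesis
    using assms by (intro bounded_supp_mult[where N="\<lambda>_. N"]) auto
qed

lemma bounded_supp_refl_root [intro]:
  assumes "bounded_supp f" "a \<noteq> 0" shows "bounded_supp (\<lambda>x. f (refl_root a x))"
proof -
  note [measurable] = assms(1)[THEN bounded_supp_measurable]
  from assms(1) obtain M r where f: "M \<ge> 0" "\<And>x. norm (f x) \<le> M" "\<And>x. r < norm x \<Longrightarrow> f x = 0"
    by (rule bounded_suppE) blast
  show ?thesis
    by (rule bounded_suppI[where M=M and r=r]) (use f assms(2) in \<open>auto simp: norm_refl_root\<close>)
qed

section \<open>The weight of a root system with positive multiplicities\<close>

lemma AE_off_hyperplanes:
  fixes P :: "'a::euclidean_space set"
  assumes "finite P" "0 \<notin> P"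
  shows "AE x in lborel. \<forall>a\<in>P. a \<bullet> x \<noteq> 0"
proof (rule AE_finite_allI)
  fix a assume "a \<in> P"
  then have "negligible {x. a \<bullet> x = 0}"
    using assms negligible_hyperplane[of a 0] by auto
  moreover have "{x. a \<bullet> x = 0} \<in> sets borel"
    by measurable
  ultimately have "{x. a \<bullet> x = 0} \<in> null_sets lborel"
    by (auto simp: negligible_iff_null_sets null_sets_completion_iff)
  then show "AE x in lborel. a \<bullet> x \<noteq> 0"
    by (auto dest: AE_not_in)
qed fact

text \<open>Roots of multiplicity zero are excluded: they contribute nothing to the operators, and
  without them the weight is continuous and vanishes on all root hyperplanes.\<close>

locale positive_roots =
  fixes R P :: "'a::euclidean_space set" and k :: "'a \<Rightarrow> real"
  assumes finite_R: "finite R"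
    and zero_notin_R: "0 \<notin> R"
    and refl_mem_R: "\<And>a b. a \<in> R \<Longrightarrow> b \<in> R \<Longrightarrow> refl_root a b \<in> R"
    and k_pos: "\<And>a. a \<in> R \<Longrightarrow> 0 < k a"
    and k_refl: "\<And>a b. a \<in> R \<Longrightarrow> b \<in> R \<Longrightarrow> k (refl_root a b) = k b"
    and positive: "positive_subsystem R P"
begin

lemma P_R: "a \<in> P \<Longrightarrow> a \<in> R"
  using positive by (auto simp: positive_subsystem_def)

lemma finite_P [simp]: "finite P"
  using finite_R by (rule rev_finite_subset) (auto intro: P_R)

lemma P_nonzero: "a \<in> P \<Longrightarrow> a \<noteq> 0"
  using P_R zero_notin_R by auto

lemma k_pos_P: "a \<in> P \<Longrightarrow> 0 < k a"
  using P_R k_pos by auto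

lemma uminus_R: "a \<in> R \<Longrightarrow> - a \<in> R"
  using refl_mem_R[of a a] zero_notin_R by (cases "a = 0") auto

lemma k_uminus: "a \<in> R \<Longrightarrow> k (- a) = k a"
  using k_refl[of a a] zero_notin_R by (cases "a = 0") auto

lemma P_cases: "a \<in> R \<Longrightarrow> a \<in> P \<longleftrightarrow> - a \<notin> P"
  using positive uminus_R[of a] unfolding positive_subsystem_def by force

text \<open>A reflection permutes the positive roots up to signs, so it does not change a sum or product
  over the positive roots of a quantity that does not depend on the sign of the root.\<close>

lemma bij_betw_positive_reflection:
  assumes "b \<in> P"
  shows "bij_betw (\<lambda>a. if refl_root b a \<in> P then refl_root b a else - refl_root b a) P P"
    (is "bij_betw ?s P P")
proof -
  have b: "b \<noteq> 0" using assms by (rule P_nonzero)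
  have m: "refl_root b a \<in> R" if "a \<in> P" for a
    using that assms by (simp add: P_R refl_mem_R)
  have sub: "?s ` P \<subseteq> P"
    using m P_cases by fastforce
  have "?s (?s a) = a" if "a \<in> P" for a
    using that m[OF that] P_cases[OF P_R[OF that]] by (auto simp: refl_root_involution b)
  then have inv: "\<forall>a\<in>P. ?s (?s a) = a" by blast
  show ?thesis
    by (rule bij_betw_byWitness[OF inv inv sub sub])
qed

lemma sum_refl_root:
  fixes h :: "'a \<Rightarrow> 'c::comm_monoid_add"
  assumes "b \<in> P" and even: "\<And>a. a \<in> R \<Longrightarrow> h (- a) = h a"
  shows "(\<Sum>a\<in>P. h (refl_root b a)) = (\<Sum>a\<in>P. h a)"
proof -
  have "(\<Sum>a\<in>P. h (refl_root b a))
      = (\<Sum>a\<in>P. h (if refl_root b a \<in> P then refl_root b a else - refl_root b a))"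
    by (intro sum.cong) (auto simp: even P_R refl_mem_R assms(1))
  also have "\<dots> = (\<Sum>a\<in>P. h a)"
    by (rule sum.reindex_bij_betw[OF bij_betw_positive_reflection[OF assms(1)]])
  finally show ?thesis .
qed

lemma prod_refl_root:
  fixes h :: "'a \<Rightarrow> 'c::comm_monoid_mult"
  assumes "b \<in> P" and even: "\<And>a. a \<in> R \<Longrightarrow> h (- a) = h a"
  shows "(\<Prod>a\<in>P. h (refl_root b a)) = (\<Prod>a\<in>P. h a)"
proof -
  have "(\<Prod>a\<in>P. h (refl_root b a))
      = (\<Prod>a\<in>P. h (if refl_root b a \<in> P then refl_root b a else - refl_root b a))"
    by (intro prod.cong) (auto simp: even P_R refl_mem_R assms(1))
  also have "\<dots> = (\<Prod>a\<in>P. h a)"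
    by (rule prod.reindex_bij_betw[OF bij_betw_positive_reflection[OF assms(1)]])
  finally show ?thesis .
qed

abbreviation w :: "'a \<Rightarrow> real" where "w \<equiv> weight P k"

lemma weight_eq: "w x = (\<Prod>a\<in>P. root_weight (2 * k a) (a \<bullet> x))"
  by (simp add: weight_def root_weight_def)

lemma weight_nonneg [simp]: "w x \<ge> 0"
  by (simp add: weight_eq prod_nonneg)

lemma weight_eq_0: "a \<in> P \<Longrightarrow> a \<bullet> x = 0 \<Longrightarrow> w x = 0"
  by (auto simp: weight_eq intro!: prod_zero bexI[of _ a])

lemma weight_refl_root: "b \<in> P \<Longrightarrow> w (refl_root b x) = w x"
proof -
  assume b: "b \<in> P"
  have "w (refl_root b x) = (\<Prod>a\<in>P. root_weight (2 * k (refl_root b a)) (refl_root b a \<bullet> x))"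
    unfolding weight_eq
    by (intro prod.cong) (auto simp: refl_root_adjoint k_refl P_R b)
  also have "\<dots> = w x"
    unfolding weight_eq
    by (rule prod_refl_root[OF b]) (simp add: k_uminus)
  finally show ?thesis .
qed

lemma continuous_on_weight_subset: "A \<subseteq> P \<Longrightarrow> continuous_on S (\<lambda>x. \<Prod>a\<in>A. root_weight (2 * k a) (a \<bullet> x))"
  using k_pos_P by (intro continuous_intros) (auto simp: subset_iff)

lemma continuous_on_weight: "continuous_on S w"
  unfolding weight_eq[abs_def] by (rule continuous_on_weight_subset) simp

lemma weight_measurable [measurable]: "w \<in> borel_measurable borel"
  by (intro borel_measurable_continuous_onI continuous_on_weight)

lemma AE_regular: "AE x in lborel. \<forall>a\<in>P. a \<bullet> x \<noteq> 0"
  using P_nonzero by (intro AE_off_hyperplanes) auto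

lemma integrable_weight:
  assumes "bounded_supp h"
  shows "integrable lborel (\<lambda>x. h x * of_real (w x))"
proof -
  note [measurable] = assms[THEN bounded_supp_measurable]
  from assms obtain M r where h: "M \<ge> 0" "\<And>x. norm (h x) \<le> M" "\<And>x. r < norm x \<Longrightarrow> h x = 0"
    by (rule bounded_suppE) blast
  have "integrable lborel (\<lambda>x. indicator (cball 0 r) x *\<^sub>R (M * w x))"
    by (intro borel_integrable_compact continuous_intros continuous_on_weight compact_cball)
  then show ?thesis
  proof (rule Bochner_Integration.integrable_bound)
    show "AE x in lborel. norm (h x * of_real (w x)) \<le> norm (indicator (cball 0 r) x *\<^sub>R (M * w x))"
    proof (rule AE_I2)
      fix x
      have "norm (h x * of_real (w x)) \<le> M * w x"
        using h(2)[of x] by (simp add: norm_mult mult_right_mono)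
      then show "norm (h x * of_real (w x)) \<le> norm (indicator (cball 0 r) x *\<^sub>R (M * w x))"
        using h(1) h(3)[of x] by (cases "norm x \<le> r") (auto simp: abs_mult)
    qed
  qed measurable
qed

text \<open>All factors of the weight except the one that belongs to \<open>a\<close> are bounded on the support of
  \<open>h\<close>, and that one compensates the pole.\<close>

lemma integrable_half_coth_weight:
  assumes "bounded_supp h" and a: "a \<in> P"
  shows "integrable lborel (\<lambda>x. of_real (half_coth (a \<bullet> x)) * h x * of_real (w x))"
proof -
  note [measurable] = assms(1)[THEN bounded_supp_measurable]
  from assms(1) obtain M r where h: "M \<ge> 0" "\<And>x. norm (h x) \<le> M" "\<And>x. r < norm x \<Longrightarrow> h x = 0"
    by (rule bounded_suppE) blast
  let ?q = "\<lambda>x. \<Prod>b\<in>P - {a}. root_weight (2 * k b) (b \<bullet> x)"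
  let ?\<psi> = "\<lambda>x. \<bar>half_coth (a \<bullet> x)\<bar> * root_weight (2 * k a) (a \<bullet> x)"
  have p: "2 * k a > 0" using a k_pos_P by simp
  have [measurable]: "root_weight (2 * k a) \<in> borel_measurable borel"
    by (intro borel_measurable_continuous_onI continuous_intros p)
  have [measurable]: "cball (0::'a) r \<in> sets borel"
    by simp
  have w: "w x = root_weight (2 * k a) (a \<bullet> x) * ?q x" for x
    unfolding weight_eq using a by (simp add: prod.remove)
  have "bounded (?q ` cball 0 r)"
    by (intro compact_imp_bounded compact_continuous_image continuous_on_weight_subset) auto
  then obtain C where C: "\<forall>y\<in>?q ` cball 0 r. norm y \<le> C"
    unfolding bounded_iff by blast
  have "integrable lborel (\<lambda>x. indicator (cball 0 r) x *\<^sub>R ?\<psi> x)"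
  proof (rule integrableI_bounded)
    have "(\<integral>\<^sup>+x. norm (indicator (cball 0 r) x *\<^sub>R ?\<psi> x) \<partial>lborel)
        = (\<integral>\<^sup>+x. ennreal (?\<psi> x) * indicator (cball 0 r) x \<partial>lborel)"
      by (intro nn_integral_cong) (auto simp: indicator_def abs_mult)
    also have "\<dots> < \<infinity>"
      using P_nonzero[OF a] p by (rule nn_integral_half_coth_root_weight_cball)
    finally show "(\<integral>\<^sup>+x. norm (indicator (cball 0 r) x *\<^sub>R ?\<psi> x) \<partial>lborel) < \<infinity>" .
  qed measurable
  then have "integrable lborel (\<lambda>x. (M * C) * (indicator (cball 0 r) x *\<^sub>R ?\<psi> x))"
    by (rule integrable_mult_right)
  then show ?thesis
  proof (rule Bochner_Integration.integrable_bound)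
    show "AE x in lborel. norm (of_real (half_coth (a \<bullet> x)) * h x * of_real (w x))
        \<le> norm ((M * C) * (indicator (cball 0 r) x *\<^sub>R ?\<psi> x))"
    proof (rule AE_I2)
      fix x
      show "norm (of_real (half_coth (a \<bullet> x)) * h x * of_real (w x))
        \<le> norm ((M * C) * (indicator (cball 0 r) x *\<^sub>R ?\<psi> x))"
      proof (cases "norm x \<le> r")
        case True
        then have q: "?q x \<le> C" "0 \<le> ?q x"
          using C by (auto simp: abs_le_iff intro!: prod_nonneg)
        have "norm (of_real (half_coth (a \<bullet> x)) * h x * of_real (w x)) = (norm (h x) * ?q x) * ?\<psi> x"
          unfolding w using q by (simp add: norm_mult abs_mult del: of_real_prod)
        also have "\<dots> \<le> (M * C) * ?\<psi> x"
          using h q by (intro mult_right_mono mult_mono) auto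
        finally show ?thesis
          using True h(1) q by (simp add: abs_mult)
      qed (use h in simp)
    qed
  qed measurable
qed


lemma weight_line_has_derivative:
  fixes x v :: 'a
  assumes reg: "\<And>a. a \<in> P \<Longrightarrow> a \<bullet> (x + \<tau> *\<^sub>R v) \<noteq> 0"
  shows "((\<lambda>\<tau>. w (x + \<tau> *\<^sub>R v)) has_real_derivative
    w (x + \<tau> *\<^sub>R v) * (\<Sum>a\<in>P. 2 * k a * (a \<bullet> v) * half_coth (a \<bullet> (x + \<tau> *\<^sub>R v)))) (at \<tau>)"
proof -
  let ?s = "\<lambda>a \<tau>. a \<bullet> (x + \<tau> *\<^sub>R v)"
  have "((\<lambda>\<tau>. w (x + \<tau> *\<^sub>R v)) has_real_derivative w (x + \<tau> *\<^sub>R v) *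
     (\<Sum>a\<in>P. (2 * k a * half_coth (?s a \<tau>) * root_weight (2 * k a) (?s a \<tau>) * (a \<bullet> v))
        / root_weight (2 * k a) (?s a \<tau>))) (at \<tau>)"
    unfolding weight_eq
  proof (rule has_field_derivative_prod')
    fix a assume a: "a \<in> P"
    show "root_weight (2 * k a) (?s a \<tau>) \<noteq> 0"
      using reg[OF a] by (simp add: root_weight_def)
    have "(?s a has_real_derivative a \<bullet> v) (at \<tau>)"
      unfolding inner_add_right inner_scaleR_right by (auto intro!: derivative_eq_intros)
    from DERIV_chain2[OF root_weight_has_derivative[OF reg[OF a]] this]
    show "((\<lambda>\<tau>. root_weight (2 * k a) (?s a \<tau>)) has_real_derivative
        2 * k a * half_coth (?s a \<tau>) * root_weight (2 * k a) (?s a \<tau>) * (a \<bullet> v)) (at \<tau>)" .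
  qed
  also have "(\<Sum>a\<in>P. (2 * k a * half_coth (?s a \<tau>) * root_weight (2 * k a) (?s a \<tau>) * (a \<bullet> v))
        / root_weight (2 * k a) (?s a \<tau>)) = (\<Sum>a\<in>P. 2 * k a * (a \<bullet> v) * half_coth (?s a \<tau>))"
    using reg by (intro sum.cong) (auto simp: root_weight_def)
  finally show ?thesis .
qed

end

lemma frechet_line_has_vector_derivative:
  assumes "f differentiable (at (x + \<tau> *\<^sub>R v))"
  shows "((\<lambda>\<tau>. f (x + \<tau> *\<^sub>R v)) has_vector_derivative frechet_derivative f (at (x + \<tau> *\<^sub>R v)) v) (at \<tau>)"
proof -
  let ?D = "frechet_derivative f (at (x + \<tau> *\<^sub>R v))"
  have D: "(f has_derivative ?D) (at (x + \<tau> *\<^sub>R v))"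
    using assms by (simp add: frechet_derivative_works)
  have "((\<lambda>\<tau>. x + \<tau> *\<^sub>R v) has_derivative (\<lambda>t. t *\<^sub>R v)) (at \<tau>)"
    by (auto intro!: derivative_eq_intros)
  from has_derivative_compose[OF this D] show ?thesis
    using has_derivative_linear[OF D] by (simp add: has_vector_derivative_def linear_scale)
qed

lemma frechet_derivative_eq_0_outside:
  fixes f :: "'a::real_normed_vector \<Rightarrow> 'b::real_normed_vector"
  assumes "\<And>x. r < norm x \<Longrightarrow> f x = 0" "r < norm x"
  shows "frechet_derivative f (at x) v = 0"
proof -
  have "open {x::'a. r < norm x}"
    by (intro open_Collect_less continuous_intros)
  then have "(f has_derivative (\<lambda>h. 0)) (at x)"
    by (rule has_derivative_transform_within_open[OF has_derivative_const[of 0]]) (use assms in auto)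
  then show ?thesis
    by (simp add: frechet_derivative_at[symmetric])
qed

context positive_roots begin

text \<open>The sum with \<open>half_coth\<close> is the logarithmic derivative of the weight. On a line that lies in
  a root hyperplane the weight vanishes identically; every other line meets the hyperplanes in finitely many
  points, and the product is continuous along it.\<close>

lemma integral_weight_by_parts:
  fixes h :: "'a \<Rightarrow> complex"
  assumes diff: "\<And>x. h differentiable (at x)"
    and cont: "continuous_on UNIV (\<lambda>x. frechet_derivative h (at x) v)"
    and supp: "\<And>x. r < norm x \<Longrightarrow> h x = 0"
  shows "(\<integral>x. (frechet_derivative h (at x) v
      + h x * of_real (\<Sum>a\<in>P. 2 * k a * (a \<bullet> v) * half_coth (a \<bullet> x))) * of_real (w x) \<partial>lborel) = 0"
proof -
  let ?m = "\<lambda>x. \<Sum>a\<in>P. 2 * k a * (a \<bullet> v) * half_coth (a \<bullet> x)"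
  let ?F = "\<lambda>x. h x * of_real (w x)"
  let ?G = "\<lambda>x. (frechet_derivative h (at x) v + h x * of_real (?m x)) * of_real (w x)"
  have conth: "continuous_on S h" for S
    using diff by (intro continuous_at_imp_continuous_on ballI differentiable_imp_continuous_within)
  have h: "bounded_supp h"
    using conth supp by (rule bounded_supp_continuous)
  have h': "bounded_supp (\<lambda>x. frechet_derivative h (at x) v)"
    using cont frechet_derivative_eq_0_outside[OF supp] by (rule bounded_supp_continuous)
  have "?G = (\<lambda>x. frechet_derivative h (at x) v * of_real (w x)
      + (\<Sum>a\<in>P. of_real (2 * k a * (a \<bullet> v)) * (of_real (half_coth (a \<bullet> x)) * h x * of_real (w x))))"
    by (simp add: fun_eq_iff algebra_simps sum_distrib_left sum_distrib_right)
  moreover have "integrable lborel \<dots>"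
    using h h' by (intro Bochner_Integration.integrable_add integrable_weight Bochner_Integration.integrable_sum
        integrable_mult_right integrable_half_coth_weight)
  ultimately have G: "integrable lborel ?G" by simp
  show ?thesis
  proof (rule integral_directional_derivative_eq_0[OF integrable_weight[OF h] G, where v=v])
    fix x :: 'a
    show "((\<lambda>\<tau>. ?G (x + \<tau> *\<^sub>R v)) has_integral ?F (x + v) - ?F x) {0..1}"
    proof (cases "\<exists>a\<in>P. a \<bullet> v = 0 \<and> a \<bullet> x = 0")
      case True
      then obtain a where a: "a \<in> P" "a \<bullet> v = 0" "a \<bullet> x = 0" by blast
      then have "w (x + \<tau> *\<^sub>R v) = 0" for \<tau>
        by (intro weight_eq_0[of a]) (auto simp: inner_add_right)
      from this this[of 0] this[of 1] show ?thesis by simp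
    next
      case False
      let ?S = "(\<lambda>a. - (a \<bullet> x) / (a \<bullet> v)) ` P"
      have "((\<lambda>\<tau>. ?G (x + \<tau> *\<^sub>R v)) has_integral ?F (x + 1 *\<^sub>R v) - ?F (x + 0 *\<^sub>R v)) {0..1}"
      proof (rule fundamental_theorem_of_calculus_interior_strong[of ?S])
        fix \<tau> assume \<tau>: "\<tau> \<in> {0<..<1} - ?S"
        have reg: "a \<bullet> (x + \<tau> *\<^sub>R v) \<noteq> 0" if a: "a \<in> P" for a
        proof (cases "a \<bullet> v = 0")
          case True
          with False a show ?thesis by (auto simp: inner_add_right)
        next
          case nz: False
          have "\<tau> \<noteq> - (a \<bullet> x) / (a \<bullet> v)" using \<tau> a by blast
          then have "\<tau> * (a \<bullet> v) \<noteq> - (a \<bullet> x)"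
            using nz by (metis nonzero_eq_divide_eq)
          then show ?thesis by (auto simp: inner_add_right)
        qed
        show "((\<lambda>\<tau>. ?F (x + \<tau> *\<^sub>R v)) has_vector_derivative ?G (x + \<tau> *\<^sub>R v)) (at \<tau>)"
          using has_vector_derivative_mult[OF frechet_line_has_vector_derivative[OF diff, where x=x and \<tau>=\<tau> and v=v]
              has_vector_derivative_of_real[OF weight_line_has_derivative[OF reg]]]
          by (simp add: algebra_simps sum_distrib_left sum_distrib_right)
      next
        show "continuous_on {0..1} (\<lambda>\<tau>. ?F (x + \<tau> *\<^sub>R v))"
          by (intro continuous_intros continuous_on_compose2[OF conth]
              continuous_on_compose2[OF continuous_on_weight[of UNIV]]) auto
      qed auto
      then show ?thesis by simp
    qed
  qed
qed

end


section \<open>Smooth functions\<close>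

lemma smooth_differentiable: "smooth f \<Longrightarrow> f differentiable (at x)"
  unfolding smooth_def by (metis continuously_differentiable.simps(2))

lemma smooth_frechet_derivative: "smooth f \<Longrightarrow> smooth (\<lambda>x. frechet_derivative f (at x) v)"
  unfolding smooth_def by (metis continuously_differentiable.simps(2))

lemma smooth_continuous_on: "smooth f \<Longrightarrow> continuous_on S f"
  unfolding smooth_def
  by (metis continuously_differentiable.simps(1) continuous_on_subset subset_UNIV)

lemma frechet_derivative_cnj:
  assumes "f differentiable (at x)"
  shows "frechet_derivative (\<lambda>x. cnj (f x)) (at x) = (\<lambda>v. cnj (frechet_derivative f (at x) v))"
proof -
  have "(f has_derivative frechet_derivative f (at x)) (at x)"
    using assms by (simp add: frechet_derivative_works)
  from bounded_linear.has_derivative[OF bounded_linear_cnj this]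
  show ?thesis by (simp add: frechet_derivative_at[symmetric])
qed

lemma continuously_differentiable_cnj:
  "continuously_differentiable n f \<Longrightarrow> continuously_differentiable n (\<lambda>x. cnj (f x))"
proof (induction n arbitrary: f)
  case 0
  then show ?case by (auto intro!: continuous_intros)
next
  case (Suc n)
  then have "(\<lambda>x. cnj (f x)) differentiable (at x)" for x
    using bounded_linear.has_derivative[OF bounded_linear_cnj]
    unfolding differentiable_def continuously_differentiable.simps by blast
  with Suc show ?case
    by (simp add: frechet_derivative_cnj)
qed

lemma smooth_cnj: "smooth f \<Longrightarrow> smooth (\<lambda>x. cnj (f x))"
  by (simp add: smooth_def continuously_differentiable_cnj)

section \<open>The Laplacian away from the root hyperplanes\<close>

definition coth_diff :: "'a::euclidean_space \<Rightarrow> ('a \<Rightarrow> complex) \<Rightarrow> 'a \<Rightarrow> complex" where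
  "coth_diff a f x = of_real (half_coth (a \<bullet> x)) * (f x - f (refl_root a x))"

text \<open>The contribution of one root to a Dunkl-Cherednik operator, with the share
  \<open>- f x / 2\<close> of the term with \<open>rho\<close> included.\<close>

definition root_term :: "'a::euclidean_space \<Rightarrow> ('a \<Rightarrow> complex) \<Rightarrow> 'a \<Rightarrow> complex" where
  "root_term a f x = coth_diff a f x - f (refl_root a x) / 2"

text \<open>The Laplacian with the operators multiplied out. By \<open>x / 0 = 0\<close> the formula makes sense
  everywhere; off the root hyperplanes it is the Laplacian.\<close>

definition explicit_laplacian ::
    "'a::euclidean_space set \<Rightarrow> 'a set \<Rightarrow> ('a \<Rightarrow> real) \<Rightarrow> ('a \<Rightarrow> complex) \<Rightarrow> 'a \<Rightarrow> complex" where
  "explicit_laplacian B P k f x =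
     (\<Sum>\<xi>\<in>B. frechet_derivative (\<lambda>y. frechet_derivative f (at y) \<xi>) (at x) \<xi>)
     + (\<Sum>a\<in>P. of_real (2 * k a * half_coth (a \<bullet> x)) * frechet_derivative f (at x) a)
     + (\<Sum>a\<in>P. of_real (k a * (a \<bullet> a) * half_coth_deriv (a \<bullet> x)) * (f x - f (refl_root a x)))
     + (\<Sum>a\<in>P. \<Sum>b\<in>P. of_real (k a * k b * (a \<bullet> b)) *
         (coth_diff b (coth_diff a f) x + f (refl_root a (refl_root b x)) / 4))"

lemma orthonormal_basis_finite: "orthonormal_basis B \<Longrightarrow> finite B"
  unfolding orthonormal_basis_def by (intro pairwise_orthogonal_imp_finite) auto

lemma orthonormal_basis_expansion:
  "orthonormal_basis B \<Longrightarrow> (\<Sum>b\<in>B. (x \<bullet> b) *\<^sub>R b) = x"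
  using orthonormal_basis_finite[of B] unfolding orthonormal_basis_def
  by (intro orthonormal_basis_expand) auto

lemma orthonormal_basis_sum_linear:
  fixes L :: "'a::euclidean_space \<Rightarrow> complex"
  assumes "orthonormal_basis B" "linear L"
  shows "(\<Sum>b\<in>B. of_real (x \<bullet> b) * L b) = L x"
proof -
  have "L x = L (\<Sum>b\<in>B. (x \<bullet> b) *\<^sub>R b)"
    using assms by (simp add: orthonormal_basis_expansion)
  also have "\<dots> = (\<Sum>b\<in>B. of_real (x \<bullet> b) * L b)"
    using assms by (simp add: linear_sum linear_scale scaleR_conv_of_real)
  finally show ?thesis ..
qed

lemma orthonormal_basis_sum_inner:
  assumes "orthonormal_basis B"
  shows "(\<Sum>b\<in>B. (x \<bullet> b) * (y \<bullet> b)) = x \<bullet> y"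
proof -
  have "x \<bullet> y = (\<Sum>b\<in>B. (x \<bullet> b) *\<^sub>R b) \<bullet> y"
    using assms by (simp add: orthonormal_basis_expansion)
  also have "\<dots> = (\<Sum>b\<in>B. (x \<bullet> b) * (y \<bullet> b))"
    by (simp only: inner_sum_left inner_scaleR_left) (simp add: inner_commute)
  finally show ?thesis ..
qed

definition root_term_deriv :: "'a::euclidean_space \<Rightarrow> ('a \<Rightarrow> complex) \<Rightarrow> 'a \<Rightarrow> 'a \<Rightarrow> complex" where
  "root_term_deriv a f x v =
     of_real (half_coth_deriv (a \<bullet> x) * (a \<bullet> v)) * (f x - f (refl_root a x))
     + of_real (half_coth (a \<bullet> x)) *
        (frechet_derivative f (at x) v - frechet_derivative f (at (refl_root a x)) (refl_root a v))
     - frechet_derivative f (at (refl_root a x)) (refl_root a v) / 2"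

lemma root_term_has_derivative:
  assumes diff: "\<And>x. f differentiable (at x)" and ax: "a \<bullet> x \<noteq> 0"
  shows "(root_term a f has_derivative root_term_deriv a f x) (at x)"
proof -
  have D: "(f has_derivative frechet_derivative f (at y)) (at y)" for y
    using diff by (simp add: frechet_derivative_works)
  have r: "(refl_root a has_derivative refl_root a) (at x)"
    by (rule bounded_linear_imp_has_derivative[OF bounded_linear_refl_root])
  have Dr: "((\<lambda>x. f (refl_root a x)) has_derivative
      (\<lambda>v. frechet_derivative f (at (refl_root a x)) (refl_root a v))) (at x)"
    by (rule has_derivative_compose[OF r D])
  have "((\<lambda>x. a \<bullet> x) has_derivative (\<lambda>v. a \<bullet> v)) (at x)"
    by (auto intro!: derivative_eq_intros)
  from has_derivative_compose[OF this half_coth_has_derivative[OF ax, unfolded has_field_derivative_def]]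
  have "((\<lambda>x. half_coth (a \<bullet> x)) has_derivative (\<lambda>v. half_coth_deriv (a \<bullet> x) * (a \<bullet> v))) (at x)" .
  then have c: "((\<lambda>x. complex_of_real (half_coth (a \<bullet> x))) has_derivative
      (\<lambda>v. of_real (half_coth_deriv (a \<bullet> x) * (a \<bullet> v)))) (at x)"
    by (rule has_derivative_of_real)
  show ?thesis
    unfolding root_term_def[abs_def] coth_diff_def root_term_deriv_def[abs_def]
    by (rule has_derivative_eq_rhs[OF has_derivative_diff[OF has_derivative_mult[OF c
            has_derivative_diff[OF D Dr]] bounded_linear.has_derivative[OF bounded_linear_divide Dr]]])
       (simp add: fun_eq_iff algebra_simps)
qed

text \<open>These are the two places where a derivative of \<open>f\<close> meets the root \<open>a\<close>: the outer operator
  differentiates \<open>root_term a f\<close>, or \<open>root_term a\<close> acts on a derivative of \<open>f\<close>. Since \<open>a\<close> is mapped to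
  \<open>- a\<close>, the derivatives at the reflected point cancel.\<close>

lemma root_term_deriv_plus_root_term:
  assumes diff: "\<And>x. f differentiable (at x)" and a: "a \<noteq> 0"
  shows "root_term_deriv a f x a + root_term a (\<lambda>y. frechet_derivative f (at y) a) x
    = of_real (2 * half_coth (a \<bullet> x)) * frechet_derivative f (at x) a
      + of_real ((a \<bullet> a) * half_coth_deriv (a \<bullet> x)) * (f x - f (refl_root a x))"
  using a linear_neg[OF linear_frechet_derivative[OF diff]]
  by (simp add: root_term_deriv_def root_term_def coth_diff_def algebra_simps)

context positive_roots begin

lemma regular_refl_root:
  assumes "b \<in> P" "\<forall>a\<in>P. a \<bullet> x \<noteq> 0"
  shows "\<forall>a\<in>P. a \<bullet> refl_root b x \<noteq> 0"
proof
  fix a assume a: "a \<in> P"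
  then have "refl_root b a \<in> R" using assms by (simp add: P_R refl_mem_R)
  then have "refl_root b a \<in> P \<or> - refl_root b a \<in> P" using P_cases by blast
  then have "refl_root b a \<bullet> x \<noteq> 0"
  proof
    assume "- refl_root b a \<in> P"
    then have "(- refl_root b a) \<bullet> x \<noteq> 0" using assms by blast
    then show ?thesis by simp
  qed (use assms in blast)
  then show "a \<bullet> refl_root b x \<noteq> 0" by (simp add: refl_root_adjoint)
qed

lemma open_regular: "open {x. \<forall>a\<in>P. a \<bullet> x \<noteq> 0}"
proof -
  have "{x. \<forall>a\<in>P. a \<bullet> x \<noteq> 0} = (\<Inter>a\<in>P. {x. a \<bullet> x \<noteq> 0})" by auto
  moreover have "open {x. a \<bullet> x \<noteq> 0}" for a :: 'a
    by (intro open_Collect_neq continuous_intros)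
  ultimately show ?thesis by (simp add: open_INT)
qed

lemma dunkl_cherednik_regular:
  assumes "\<forall>a\<in>P. a \<bullet> x \<noteq> 0"
  shows "dunkl_cherednik P k \<xi> f x = frechet_derivative f (at x) \<xi>
    + (\<Sum>a\<in>P. of_real (k a * (a \<bullet> \<xi>)) * root_term a f x)"
proof -
  have q: "root_quotient a f x = root_term a f x + f x / 2" if "a \<in> P" for a
  proof -
    have "a \<bullet> x \<noteq> 0" using assms that by blast
    then have "root_quotient a f x = (f x - f (refl_root a x)) * of_real (1 / (1 - exp (- (a \<bullet> x))))"
      by (simp add: root_quotient_def)
    also have "\<dots> = (f x - f (refl_root a x)) * of_real (1 / 2 + half_coth (a \<bullet> x))"
      by (simp only: inverse_one_minus_exp[OF \<open>a \<bullet> x \<noteq> 0\<close>])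
    finally show ?thesis
      by (simp add: root_term_def coth_diff_def algebra_simps)
  qed
  have "of_real (rho P k \<bullet> \<xi>) * f x = (\<Sum>a\<in>P. of_real (k a * (a \<bullet> \<xi>)) * (f x / 2))"
    by (simp add: rho_def inner_sum_left sum_distrib_right sum_distrib_left sum_divide_distrib algebra_simps)
  moreover have "(\<Sum>a\<in>P. of_real (k a * (a \<bullet> \<xi>)) * root_quotient a f x)
     = (\<Sum>a\<in>P. of_real (k a * (a \<bullet> \<xi>)) * root_term a f x) + (\<Sum>a\<in>P. of_real (k a * (a \<bullet> \<xi>)) * (f x / 2))"
    unfolding sum.distrib[symmetric] by (intro sum.cong) (auto simp: q distrib_left)
  ultimately show ?thesis
    by (simp add: dunkl_cherednik_def)
qed

lemma frechet_derivative_dunkl_cherednik: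
  assumes f: "smooth f" and reg: "\<forall>a\<in>P. a \<bullet> x \<noteq> 0"
  shows "frechet_derivative (dunkl_cherednik P k \<xi> f) (at x) v
    = frechet_derivative (\<lambda>y. frechet_derivative f (at y) \<xi>) (at x) v
      + (\<Sum>a\<in>P. of_real (k a * (a \<bullet> \<xi>)) * root_term_deriv a f x v)"
proof -
  let ?D = "\<lambda>v. frechet_derivative (\<lambda>y. frechet_derivative f (at y) \<xi>) (at x) v
      + (\<Sum>a\<in>P. of_real (k a * (a \<bullet> \<xi>)) * root_term_deriv a f x v)"
  have "((\<lambda>x. frechet_derivative f (at x) \<xi> + (\<Sum>a\<in>P. of_real (k a * (a \<bullet> \<xi>)) * root_term a f x))
      has_derivative ?D) (at x)"
  proof (intro has_derivative_add has_derivative_sum has_derivative_mult_right)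
    show "((\<lambda>x. frechet_derivative f (at x) \<xi>) has_derivative
        frechet_derivative (\<lambda>y. frechet_derivative f (at y) \<xi>) (at x)) (at x)"
      using smooth_differentiable[OF smooth_frechet_derivative[OF f]] by (simp add: frechet_derivative_works)
    show "(root_term a f has_derivative root_term_deriv a f x) (at x)" if "a \<in> P" for a
      by (rule root_term_has_derivative) (use f reg that in \<open>auto intro: smooth_differentiable\<close>)
  qed
  then have "(dunkl_cherednik P k \<xi> f has_derivative ?D) (at x)"
    by (rule has_derivative_transform_within_open[OF _ open_regular])
       (use reg in \<open>auto simp: dunkl_cherednik_regular\<close>)
  then show ?thesis
    by (simp add: frechet_derivative_at[symmetric])
qed

text \<open>The products of one factor with \<open>half_coth\<close> and one plain reflection, taken in both orders, cancel:
  exchanging \<open>a\<close> and \<open>b\<close> in the second kind and then substituting \<open>refl_root a b\<close> for \<open>b\<close> turns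
  it into the first kind, with the opposite sign of \<open>a \<bullet> b\<close>.\<close>

lemma cross_terms_cancel:
  "(\<Sum>a\<in>P. \<Sum>b\<in>P. of_real (k a * k b * (a \<bullet> b)) *
     (of_real (half_coth (b \<bullet> x)) * (f (refl_root a x) - f (refl_root a (refl_root b x)))
      + coth_diff a f (refl_root b x))) = 0"
proof -
  let ?X = "\<lambda>a b. of_real (k a * k b * (a \<bullet> b)) *
     (of_real (half_coth (b \<bullet> x)) * (f (refl_root a x) - f (refl_root a (refl_root b x)))) :: complex"
  let ?Y = "\<lambda>a b. of_real (k a * k b * (a \<bullet> b)) * coth_diff a f (refl_root b x) :: complex"
  have "(\<Sum>a\<in>P. \<Sum>b\<in>P. ?Y a b) = (\<Sum>a\<in>P. \<Sum>b\<in>P. ?Y b a)"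
    by (rule sum.swap)
  also have "\<dots> = (\<Sum>a\<in>P. - (\<Sum>b\<in>P. ?X a b))"
  proof (rule sum.cong)
    fix a assume a: "a \<in> P"
    have "(\<Sum>b\<in>P. ?Y b a) = (\<Sum>b\<in>P. - ?X a (refl_root a b))"
    proof (rule sum.cong)
      fix b assume b: "b \<in> P"
      have "a \<bullet> refl_root a b = - (b \<bullet> a)"
        using P_nonzero[OF a] by (simp add: refl_root_adjoint[symmetric] inner_commute)
      then show "?Y b a = - ?X a (refl_root a b)"
        using a b P_nonzero[OF a]
        by (simp add: coth_diff_def refl_root_adjoint refl_root_conjugate refl_root_involution k_refl P_R)
    qed simp
    also have "\<dots> = (\<Sum>b\<in>P. - ?X a b)"
      by (rule sum_refl_root[OF a]) (simp add: k_uminus)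
    finally show "(\<Sum>b\<in>P. ?Y b a) = - (\<Sum>b\<in>P. ?X a b)"
      by (simp add: sum_negf)
  qed simp
  finally have "(\<Sum>a\<in>P. \<Sum>b\<in>P. ?X a b) + (\<Sum>a\<in>P. \<Sum>b\<in>P. ?Y a b) = 0"
    by (simp add: sum_negf)
  then show ?thesis
    by (simp add: distrib_left sum.distrib)
qed

text \<open>The operator is applied twice, and the sum over the orthonormal basis contracts the factors
  \<open>a \<bullet> \<xi>\<close>: against a derivative in direction \<open>\<xi>\<close> it yields the derivative in direction \<open>a\<close>, and against
  \<open>b \<bullet> \<xi>\<close> it yields \<open>a \<bullet> b\<close>.\<close>

lemma dunkl_laplacian_regular:
  assumes B: "orthonormal_basis B" and f: "smooth f" and reg: "\<forall>a\<in>P. a \<bullet> x \<noteq> 0"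
  shows "dunkl_laplacian B P k f x = explicit_laplacian B P k f x"
proof -
  let ?T = "\<lambda>\<xi>. dunkl_cherednik P k \<xi> f"
  let ?d = "\<lambda>\<xi> y. frechet_derivative f (at y) \<xi>"
  let ?D2 = "\<lambda>\<xi>. frechet_derivative (?d \<xi>) (at x) \<xi>"
  let ?Q = "\<lambda>a b. root_term b (root_term a f) x"
  note diff = smooth_differentiable[OF f]
  have lin: "linear (frechet_derivative f (at y))" for y
    using diff by (rule linear_frechet_derivative)
  have rt: "root_term b (?T \<xi>) x = root_term b (?d \<xi>) x
      + (\<Sum>a\<in>P. of_real (k a * (a \<bullet> \<xi>)) * ?Q a b)" if b: "b \<in> P" for b \<xi>
  proof -
    let ?c = "complex_of_real (half_coth (b \<bullet> x))"
    have rb: "\<forall>a\<in>P. a \<bullet> refl_root b x \<noteq> 0"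
      using regular_refl_root[OF b reg] .
    have alt: "root_term b g x = ?c * g x - (?c + 1 / 2) * g (refl_root b x)" for g
      by (simp add: root_term_def coth_diff_def algebra_simps)
    show ?thesis
      unfolding alt dunkl_cherednik_regular[OF reg] dunkl_cherednik_regular[OF rb]
      by (simp add: right_diff_distrib distrib_left sum_distrib_left sum_subtractf algebra_simps)
  qed
  have "dunkl_laplacian B P k f x = (\<Sum>\<xi>\<in>B. frechet_derivative (?T \<xi>) (at x) \<xi>
      + (\<Sum>b\<in>P. of_real (k b * (b \<bullet> \<xi>)) * root_term b (?T \<xi>) x))"
    unfolding dunkl_laplacian_def by (simp add: dunkl_cherednik_regular[OF reg])
  also have "\<dots> = (\<Sum>\<xi>\<in>B. ?D2 \<xi> + (\<Sum>a\<in>P. of_real (k a * (a \<bullet> \<xi>)) * root_term_deriv a f x \<xi>)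
      + (\<Sum>b\<in>P. of_real (k b * (b \<bullet> \<xi>)) * root_term b (?d \<xi>) x)
      + (\<Sum>b\<in>P. \<Sum>a\<in>P. of_real (k b * (b \<bullet> \<xi>)) * (of_real (k a * (a \<bullet> \<xi>)) * ?Q a b)))"
    by (intro sum.cong)
       (simp_all add: frechet_derivative_dunkl_cherednik[OF f reg] rt distrib_left sum.distrib sum_distrib_left)
  also have "\<dots> = (\<Sum>\<xi>\<in>B. ?D2 \<xi>)
      + (\<Sum>a\<in>P. of_real (k a) * (\<Sum>\<xi>\<in>B. of_real (a \<bullet> \<xi>) * root_term_deriv a f x \<xi>))
      + (\<Sum>b\<in>P. of_real (k b) * (\<Sum>\<xi>\<in>B. of_real (b \<bullet> \<xi>) * root_term b (?d \<xi>) x))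
      + (\<Sum>b\<in>P. \<Sum>a\<in>P. of_real (k a * k b * (\<Sum>\<xi>\<in>B. (a \<bullet> \<xi>) * (b \<bullet> \<xi>))) * ?Q a b)"
  proof -
    have "(\<Sum>\<xi>\<in>B. \<Sum>a\<in>P. of_real (k a * (a \<bullet> \<xi>)) * g a \<xi>)
        = (\<Sum>a\<in>P. of_real (k a) * (\<Sum>\<xi>\<in>B. of_real (a \<bullet> \<xi>) * g a \<xi>))" for g :: "'a \<Rightarrow> 'a \<Rightarrow> complex"
      by (subst sum.swap) (simp add: sum_distrib_left mult.assoc)
    moreover have "(\<Sum>\<xi>\<in>B. \<Sum>b\<in>P. \<Sum>a\<in>P. of_real (k b * (b \<bullet> \<xi>)) * (of_real (k a * (a \<bullet> \<xi>)) * ?Q a b))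
       = (\<Sum>b\<in>P. \<Sum>a\<in>P. of_real (k a * k b * (\<Sum>\<xi>\<in>B. (a \<bullet> \<xi>) * (b \<bullet> \<xi>))) * ?Q a b)"
    proof -
      have basis: "(\<Sum>\<xi>\<in>B. of_real (k b * (b \<bullet> \<xi>)) * (of_real (k a * (a \<bullet> \<xi>)) * q))
        = of_real (k a * k b * (\<Sum>\<xi>\<in>B. (a \<bullet> \<xi>) * (b \<bullet> \<xi>))) * q" for a b and q :: complex
        unfolding sum_distrib_left of_real_sum sum_distrib_right
        by (intro sum.cong refl) (simp add: ac_simps)
      have "(\<Sum>\<xi>\<in>B. \<Sum>b\<in>P. \<Sum>a\<in>P. of_real (k b * (b \<bullet> \<xi>)) * (of_real (k a * (a \<bullet> \<xi>)) * ?Q a b))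
        = (\<Sum>b\<in>P. \<Sum>\<xi>\<in>B. \<Sum>a\<in>P. of_real (k b * (b \<bullet> \<xi>)) * (of_real (k a * (a \<bullet> \<xi>)) * ?Q a b))"
        by (rule sum.swap)
      also have "\<dots> = (\<Sum>b\<in>P. \<Sum>a\<in>P. \<Sum>\<xi>\<in>B. of_real (k b * (b \<bullet> \<xi>)) * (of_real (k a * (a \<bullet> \<xi>)) * ?Q a b))"
        by (rule sum.cong[OF refl]) (rule sum.swap)
      finally show ?thesis
        unfolding basis .
    qed
    ultimately show ?thesis
      by (simp only: sum.distrib)
  qed
  also have "\<dots> = (\<Sum>\<xi>\<in>B. ?D2 \<xi>) + (\<Sum>a\<in>P. of_real (k a) * root_term_deriv a f x a)
      + (\<Sum>b\<in>P. of_real (k b) * root_term b (?d b) x)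
      + (\<Sum>b\<in>P. \<Sum>a\<in>P. of_real (k a * k b * (a \<bullet> b)) * ?Q a b)"
  proof -
    have "linear (root_term_deriv a f x)" if "a \<in> P" for a
      using reg that root_term_has_derivative[of f a x, OF diff] by (auto intro: has_derivative_linear)
    moreover have "linear (\<lambda>\<xi>. root_term b (?d \<xi>) x)" for b
      unfolding root_term_def coth_diff_def
      by (rule linearI) (simp_all add: linear_add[OF lin] linear_scale[OF lin] algebra_simps scaleR_conv_of_real add_divide_distrib)
    ultimately show ?thesis
      by (simp add: orthonormal_basis_sum_linear[OF B] orthonormal_basis_sum_inner[OF B] del: of_real_mult of_real_sum)
  qed
  finally have L: "dunkl_laplacian B P k f x = (\<Sum>\<xi>\<in>B. ?D2 \<xi>)
      + ((\<Sum>a\<in>P. of_real (k a) * root_term_deriv a f x a) + (\<Sum>b\<in>P. of_real (k b) * root_term b (?d b) x))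
      + (\<Sum>b\<in>P. \<Sum>a\<in>P. of_real (k a * k b * (a \<bullet> b)) * ?Q a b)"
    by (simp only: add.assoc)
  have first_order: "(\<Sum>a\<in>P. of_real (k a) * root_term_deriv a f x a) + (\<Sum>b\<in>P. of_real (k b) * root_term b (?d b) x)
     = (\<Sum>a\<in>P. of_real (2 * k a * half_coth (a \<bullet> x)) * ?d a x)
     + (\<Sum>a\<in>P. of_real (k a * (a \<bullet> a) * half_coth_deriv (a \<bullet> x)) * (f x - f (refl_root a x)))"
  proof -
    have "of_real (k a) * root_term_deriv a f x a + of_real (k a) * root_term a (?d a) x
      = of_real (2 * k a * half_coth (a \<bullet> x)) * ?d a x
        + of_real (k a * (a \<bullet> a) * half_coth_deriv (a \<bullet> x)) * (f x - f (refl_root a x))" if "a \<in> P" for a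
      unfolding distrib_left[symmetric] root_term_deriv_plus_root_term[OF diff P_nonzero[OF that]]
      by (simp add: algebra_simps)
    then show ?thesis
      unfolding sum.distrib[symmetric] by (intro sum.cong) auto
  qed
  have zeroth_order: "(\<Sum>b\<in>P. \<Sum>a\<in>P. of_real (k a * k b * (a \<bullet> b)) * ?Q a b)
     = (\<Sum>a\<in>P. \<Sum>b\<in>P. of_real (k a * k b * (a \<bullet> b)) *
         (coth_diff b (coth_diff a f) x + f (refl_root a (refl_root b x)) / 4))"
  proof -
    let ?Z = "\<lambda>a b. of_real (half_coth (b \<bullet> x)) * (f (refl_root a x) - f (refl_root a (refl_root b x)))
      + coth_diff a f (refl_root b x)"
    have Q: "?Q a b = (coth_diff b (coth_diff a f) x + f (refl_root a (refl_root b x)) / 4) - ?Z a b / 2" for a b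
      unfolding root_term_def[of b] unfolding root_term_def[of a] coth_diff_def[of b]
      by (simp add: field_simps)
    have "(\<Sum>b\<in>P. \<Sum>a\<in>P. of_real (k a * k b * (a \<bullet> b)) * ?Q a b)
       = (\<Sum>a\<in>P. \<Sum>b\<in>P. of_real (k a * k b * (a \<bullet> b)) *
         (coth_diff b (coth_diff a f) x + f (refl_root a (refl_root b x)) / 4))
       - (\<Sum>a\<in>P. \<Sum>b\<in>P. of_real (k a * k b * (a \<bullet> b)) * ?Z a b) / 2"
      unfolding Q by (subst sum.swap) (simp add: right_diff_distrib sum_subtractf sum_divide_distrib)
    then show ?thesis
      by (simp only: cross_terms_cancel) simp
  qed
  show ?thesis
    unfolding explicit_laplacian_def L first_order zeroth_order by (simp only: add.assoc)
qed

end


section \<open>Symmetry of the Laplacian\<close>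

definition smooth_supp :: "('a::euclidean_space \<Rightarrow> complex) \<Rightarrow> bool" where
  "smooth_supp f \<longleftrightarrow> smooth f \<and> (\<exists>r. \<forall>x. r < norm x \<longrightarrow> f x = 0)"

lemma smooth_supp_smooth: "smooth_supp f \<Longrightarrow> smooth f"
  by (simp add: smooth_supp_def)

lemma smooth_supp_differentiable: "smooth_supp f \<Longrightarrow> f differentiable (at x)"
  by (intro smooth_differentiable smooth_supp_smooth)

lemma smooth_supp_frechet_derivative:
  "smooth_supp f \<Longrightarrow> smooth_supp (\<lambda>x. frechet_derivative f (at x) v)"
  unfolding smooth_supp_def
  by (auto intro: smooth_frechet_derivative) (metis frechet_derivative_eq_0_outside)

lemma smooth_supp_cnj: "smooth_supp f \<Longrightarrow> smooth_supp (\<lambda>x. cnj (f x))"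
  unfolding smooth_supp_def by (auto intro: smooth_cnj)

lemma smooth_supp_bounded_supp: "smooth_supp f \<Longrightarrow> bounded_supp f"
  unfolding smooth_supp_def by (auto intro: bounded_supp_continuous smooth_continuous_on)

lemma smooth_supp_measurable [measurable_dest]: "smooth_supp f \<Longrightarrow> f \<in> borel_measurable borel"
  by (intro bounded_supp_measurable smooth_supp_bounded_supp)

lemma smooth_supp_reflection_bound:
  assumes f: "smooth_supp f"
  obtains K where "K \<ge> 0" "\<And>x. norm (f x - f (refl_root a x)) \<le> K * \<bar>a \<bullet> x\<bar>"
proof -
  let ?d = "\<lambda>x. frechet_derivative f (at x) a"
  have "bounded_supp ?d"
    using f by (intro smooth_supp_bounded_supp smooth_supp_frechet_derivative)
  then obtain M r where M: "M \<ge> 0" "\<And>x. norm (?d x) \<le> M"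
    by (rule bounded_suppE) blast
  show ?thesis
  proof (rule that[of "M * (2 / (norm a)\<^sup>2)"])
    fix x
    let ?t = "- (2 * (a \<bullet> x) / (norm a)\<^sup>2)"
    have "norm (f (x + 0 *\<^sub>R a) - f (x + ?t *\<^sub>R a)) \<le> M * norm (0 - ?t)"
    proof (rule differentiable_bound[where S=UNIV and f="\<lambda>\<tau>. f (x + \<tau> *\<^sub>R a)"])
      fix \<tau> :: real
      show "((\<lambda>\<tau>. f (x + \<tau> *\<^sub>R a)) has_derivative (\<lambda>h. h *\<^sub>R ?d (x + \<tau> *\<^sub>R a))) (at \<tau> within UNIV)"
        using frechet_line_has_vector_derivative[OF smooth_supp_differentiable[OF f], where x=x and \<tau>=\<tau> and v=a]
        by (simp add: has_vector_derivative_def)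
      show "onorm (\<lambda>h. h *\<^sub>R ?d (x + \<tau> *\<^sub>R a)) \<le> M"
        using M(2) by (intro onorm_le) (simp add: mult.commute[of M] mult_left_mono)
    qed auto
    then show "norm (f x - f (refl_root a x)) \<le> M * (2 / (norm a)\<^sup>2) * \<bar>a \<bullet> x\<bar>"
      by (simp add: refl_root_def abs_mult)
  qed (use M in simp)
qed

lemma coth_diff_measurable [measurable]:
  assumes [measurable]: "f \<in> borel_measurable borel"
  shows "coth_diff a f \<in> borel_measurable borel"
  unfolding coth_diff_def[abs_def] by measurable

lemma bounded_supp_coth_diff:
  assumes f: "smooth_supp f" and a: "a \<noteq> 0"
  shows "bounded_supp (coth_diff a f)"
proof -
  note [measurable] = f[THEN smooth_supp_measurable]
  obtain K where K: "K \<ge> 0" "\<And>x. norm (f x - f (refl_root a x)) \<le> K * \<bar>a \<bullet> x\<bar>"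
    using f by (rule smooth_supp_reflection_bound) blast
  obtain r where r: "\<And>x. r < norm x \<Longrightarrow> f x = 0"
    using f by (auto simp: smooth_supp_def)
  show ?thesis
  proof (rule bounded_suppI[where r=r and M="K * cosh (norm a * max r 0 / 2)"])
    fix x
    show "norm (coth_diff a f x) \<le> K * cosh (norm a * max r 0 / 2)"
    proof (cases "norm x \<le> r")
      case True
      have "\<bar>a \<bullet> x\<bar> \<le> norm a * norm x" by (rule Cauchy_Schwarz_ineq2)
      also have "\<dots> \<le> norm a * max r 0" using True by (intro mult_left_mono) auto
      finally have "cosh (a \<bullet> x / 2) \<le> cosh (norm a * max r 0 / 2)"
        by (subst cosh_real_abs[symmetric], subst cosh_real_nonneg_le_iff) auto
      then have c: "\<bar>half_coth (a \<bullet> x) * (a \<bullet> x)\<bar> \<le> cosh (norm a * max r 0 / 2)"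
        using abs_half_coth_mult_le[of "a \<bullet> x"] by simp
      have "norm (coth_diff a f x) \<le> \<bar>half_coth (a \<bullet> x)\<bar> * (K * \<bar>a \<bullet> x\<bar>)"
        unfolding coth_diff_def norm_mult using K by (auto intro: mult_left_mono)
      also have "\<dots> = K * \<bar>half_coth (a \<bullet> x) * (a \<bullet> x)\<bar>" by (simp add: abs_mult)
      also have "\<dots> \<le> K * cosh (norm a * max r 0 / 2)" using c K by (intro mult_left_mono)
      finally show ?thesis .
    next
      case False
      then show ?thesis using r[of x] r[of "refl_root a x"] K a
        by (simp add: coth_diff_def norm_refl_root)
    qed
    show "r < norm x \<Longrightarrow> coth_diff a f x = 0"
      using r[of x] r[of "refl_root a x"] a by (simp add: coth_diff_def norm_refl_root)
  qed measurable
qed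

lemma coth_diff_refl_root:
  "a \<noteq> 0 \<Longrightarrow> coth_diff a f (refl_root a x) = coth_diff a f x"
  by (simp add: coth_diff_def refl_root_involution flip: refl_root_adjoint) (simp add: algebra_simps)

lemma frechet_derivative_times:
  fixes f g :: "'a::euclidean_space \<Rightarrow> complex"
  assumes "f differentiable (at x)" "g differentiable (at x)"
  shows "frechet_derivative (\<lambda>x. f x * g x) (at x) v
    = frechet_derivative f (at x) v * g x + f x * frechet_derivative g (at x) v"
proof -
  have "(f has_derivative frechet_derivative f (at x)) (at x)"
    "(g has_derivative frechet_derivative g (at x)) (at x)"
    using assms by (simp_all add: frechet_derivative_works)
  from has_derivative_mult[OF this] show ?thesis
    by (simp add: frechet_derivative_at[symmetric])
qed

context positive_roots begin

text \<open>The pairing is kept bilinear, without complex conjugation, so that symmetry can be read off from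
  formulas in which \<open>f\<close> and \<open>g\<close> play the same role. Conjugation enters only at the end, because
  the Laplacian has real coefficients.\<close>

definition W_integrable :: "('a \<Rightarrow> complex) \<Rightarrow> bool" where
  "W_integrable F \<longleftrightarrow> integrable lborel (\<lambda>x. F x * of_real (w x))"

definition W_integral :: "('a \<Rightarrow> complex) \<Rightarrow> complex" where
  "W_integral F = (\<integral>x. F x * of_real (w x) \<partial>lborel)"

lemma W_integrable_bounded_supp: "bounded_supp F \<Longrightarrow> W_integrable F"
  unfolding W_integrable_def by (rule integrable_weight)

lemma W_integrable_half_coth:
  "bounded_supp F \<Longrightarrow> a \<in> P \<Longrightarrow> W_integrable (\<lambda>x. of_real (half_coth (a \<bullet> x)) * F x)"
  unfolding W_integrable_def by (rule integrable_half_coth_weight)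

lemma W_integrable_add [intro]: "W_integrable F \<Longrightarrow> W_integrable G \<Longrightarrow> W_integrable (\<lambda>x. F x + G x)"
  and W_integrable_diff [intro]: "W_integrable F \<Longrightarrow> W_integrable G \<Longrightarrow> W_integrable (\<lambda>x. F x - G x)"
  and W_integrable_cmult [intro]: "W_integrable F \<Longrightarrow> W_integrable (\<lambda>x. c * F x)"
  by (simp_all add: W_integrable_def distrib_right left_diff_distrib mult.assoc)

lemma W_integrable_sum [intro]:
  "(\<And>i. i \<in> A \<Longrightarrow> W_integrable (F i)) \<Longrightarrow> W_integrable (\<lambda>x. \<Sum>i\<in>A. F i x)"
  by (auto simp: W_integrable_def sum_distrib_right)

lemma W_integral_add: "W_integrable F \<Longrightarrow> W_integrable G \<Longrightarrow>
    W_integral (\<lambda>x. F x + G x) = W_integral F + W_integral G"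
  and W_integral_diff: "W_integrable F \<Longrightarrow> W_integrable G \<Longrightarrow>
    W_integral (\<lambda>x. F x - G x) = W_integral F - W_integral G"
  and W_integral_cmult: "W_integral (\<lambda>x. c * F x) = c * W_integral F"
  by (simp_all add: W_integrable_def W_integral_def distrib_right left_diff_distrib mult.assoc)

lemma W_integral_sum: "(\<And>i. i \<in> A \<Longrightarrow> W_integrable (F i)) \<Longrightarrow>
    W_integral (\<lambda>x. \<Sum>i\<in>A. F i x) = (\<Sum>i\<in>A. W_integral (F i))"
  by (simp add: W_integrable_def W_integral_def sum_distrib_right)

lemma W_integral_refl_root:
  assumes b: "b \<in> P" and [measurable]: "F \<in> borel_measurable borel"
  shows "W_integral (\<lambda>x. F (refl_root b x)) = W_integral F"
proof -
  have "W_integral F = (\<integral>x. F (refl_root b x) * of_real (w (refl_root b x)) \<partial>lborel)"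
    unfolding W_integral_def
    by (rule integral_lborel_refl_root[symmetric]) (use P_nonzero[OF b] in auto)
  then show ?thesis
    unfolding W_integral_def by (simp add: weight_refl_root[OF b])
qed

text \<open>The main device for symmetry: an odd factor \<open>e\<close> sees only the odd part of \<open>g\<close>.\<close>

lemma W_integral_odd:
  assumes b: "b \<in> P" and odd: "\<And>x. e (refl_root b x) = - e x"
    and [measurable]: "e \<in> borel_measurable borel" "g \<in> borel_measurable borel"
    and int: "W_integrable (\<lambda>x. e x * g x)" "W_integrable (\<lambda>x. e x * g (refl_root b x))"
  shows "W_integral (\<lambda>x. e x * g x) = W_integral (\<lambda>x. e x * (g x - g (refl_root b x))) / 2"
proof -
  have "W_integral (\<lambda>x. e x * g x) = W_integral (\<lambda>x. e (refl_root b x) * g (refl_root b x))"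
    by (rule W_integral_refl_root[OF b, symmetric]) measurable
  also have "\<dots> = - W_integral (\<lambda>x. e x * g (refl_root b x))"
    using W_integral_cmult[of "- 1"] by (simp add: odd)
  finally show ?thesis
    using W_integral_diff[OF int] by (simp add: right_diff_distrib)
qed

text \<open>Partial integration of \<open>frechet_derivative f (at x) \<xi> * g x\<close>: the logarithmic derivative of the
  weight produces precisely the terms with \<open>half_coth\<close>, after summation over the basis.\<close>

lemma first_order_form:
  assumes f: "smooth_supp f" and g: "smooth_supp g" and B: "orthonormal_basis B"
  defines "F \<equiv> \<lambda>x. ((\<Sum>\<xi>\<in>B. frechet_derivative (\<lambda>y. frechet_derivative f (at y) \<xi>) (at x) \<xi>)
     + (\<Sum>a\<in>P. of_real (2 * k a * half_coth (a \<bullet> x)) * frechet_derivative f (at x) a)) * g x"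
  shows "W_integrable F"
    and "W_integral F = - (\<Sum>\<xi>\<in>B. W_integral (\<lambda>x. frechet_derivative f (at x) \<xi> * frechet_derivative g (at x) \<xi>))"
proof -
  let ?d = "\<lambda>f \<xi> x. frechet_derivative f (at x) \<xi>"
  let ?m = "\<lambda>\<xi> x. complex_of_real (\<Sum>a\<in>P. 2 * k a * (a \<bullet> \<xi>) * half_coth (a \<bullet> x))"
  have lin: "linear (frechet_derivative f (at y))" for y
    using smooth_supp_differentiable[OF f] by (rule linear_frechet_derivative)
  have bd: "bounded_supp (?d f \<xi>)" "bounded_supp (?d g \<xi>)" "bounded_supp (?d (?d f \<xi>) \<xi>)" "bounded_supp g" for \<xi>
    using f g by (auto intro!: smooth_supp_bounded_supp smooth_supp_frechet_derivative)
  let ?G = "\<lambda>\<xi> x. ?d (?d f \<xi>) \<xi> x * g x + ?m \<xi> x * (?d f \<xi> x * g x)"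
  let ?H = "\<lambda>\<xi> x. ?d f \<xi> x * ?d g \<xi> x"
  have G: "W_integrable (?G \<xi>)" for \<xi>
  proof -
    have "?G \<xi> = (\<lambda>x. ?d (?d f \<xi>) \<xi> x * g x
      + (\<Sum>a\<in>P. of_real (2 * k a * (a \<bullet> \<xi>)) * (of_real (half_coth (a \<bullet> x)) * (?d f \<xi> x * g x))))"
      by (simp add: fun_eq_iff sum_distrib_right mult.assoc)
    moreover have "W_integrable (\<lambda>x. ?d (?d f \<xi>) \<xi> x * g x)"
      by (intro W_integrable_bounded_supp bounded_supp_times bd)
    moreover have "W_integrable (\<lambda>x. \<Sum>a\<in>P. of_real (2 * k a * (a \<bullet> \<xi>)) * (of_real (half_coth (a \<bullet> x)) * (?d f \<xi> x * g x)))"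
      by (intro W_integrable_sum W_integrable_cmult W_integrable_half_coth bounded_supp_times bd)
    ultimately show ?thesis
      by (simp only: W_integrable_add)
  qed
  have H: "W_integrable (?H \<xi>)" for \<xi>
    by (intro W_integrable_bounded_supp bounded_supp_times bd)
  have parts: "W_integral (?G \<xi>) = - W_integral (?H \<xi>)" for \<xi>
  proof -
    let ?h = "\<lambda>x. ?d f \<xi> x * g x"
    have dh: "?d ?h \<xi> x = ?d (?d f \<xi>) \<xi> x * g x + ?d f \<xi> x * ?d g \<xi> x" for x
      using f g by (intro frechet_derivative_times smooth_supp_differentiable smooth_supp_frechet_derivative)
    obtain r where r: "\<And>x. r < norm x \<Longrightarrow> g x = 0"
      using g by (auto simp: smooth_supp_def)
    have "(\<integral>x. (?d ?h \<xi> x + ?h x * ?m \<xi> x) * of_real (w x) \<partial>lborel) = 0"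
    proof (rule integral_weight_by_parts[where r=r])
      show "?h differentiable (at x)" for x
        using f g by (intro differentiable_mult smooth_supp_differentiable smooth_supp_frechet_derivative)
      show "continuous_on UNIV (\<lambda>x. ?d ?h \<xi> x)"
        unfolding dh using f g
        by (intro continuous_intros smooth_continuous_on smooth_supp_smooth smooth_supp_frechet_derivative)
    qed (use r in simp)
    then have "W_integral (\<lambda>x. ?G \<xi> x + ?H \<xi> x) = 0"
      unfolding W_integral_def dh by (simp add: algebra_simps)
    then show ?thesis
      using W_integral_add[OF G H] by (simp add: eq_neg_iff_add_eq_0)
  qed
  have F: "F = (\<lambda>x. \<Sum>\<xi>\<in>B. ?G \<xi> x)"
  proof
    fix x
    have "(\<Sum>\<xi>\<in>B. ?m \<xi> x * ?d f \<xi> x)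
        = (\<Sum>a\<in>P. of_real (2 * k a * half_coth (a \<bullet> x)) * (\<Sum>\<xi>\<in>B. of_real (a \<bullet> \<xi>) * ?d f \<xi> x))"
      unfolding of_real_sum sum_distrib_right sum_distrib_left
      by (subst sum.swap) (simp add: ac_simps)
    also have "\<dots> = (\<Sum>a\<in>P. of_real (2 * k a * half_coth (a \<bullet> x)) * ?d f a x)"
      by (simp add: orthonormal_basis_sum_linear[OF B lin])
    finally have "F x = ((\<Sum>\<xi>\<in>B. ?d (?d f \<xi>) \<xi> x) + (\<Sum>\<xi>\<in>B. ?m \<xi> x * ?d f \<xi> x)) * g x"
      by (simp only: F_def)
    then show "F x = (\<Sum>\<xi>\<in>B. ?G \<xi> x)"
      by (simp only: distrib_right sum.distrib sum_distrib_right mult.assoc)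
  qed
  show "W_integrable F"
    unfolding F by (intro W_integrable_sum G)
  show "W_integral F = - (\<Sum>\<xi>\<in>B. W_integral (?H \<xi>))"
    unfolding F by (simp only: W_integral_sum[OF G] parts sum_negf)
qed

lemma half_coth_deriv_form:
  assumes f: "smooth_supp f" and g: "smooth_supp g" and a: "a \<in> P"
  defines "e \<equiv> \<lambda>f x. of_real (half_coth_deriv (a \<bullet> x)) * (f x - f (refl_root a x))"
  shows "W_integrable (\<lambda>x. e f x * g x)"
    and "W_integral (\<lambda>x. e f x * g x) = W_integral (\<lambda>x. of_real (half_coth_deriv (a \<bullet> x)) *
      ((f x - f (refl_root a x)) * (g x - g (refl_root a x)))) / 2"
proof -
  note [measurable] = f[THEN smooth_supp_measurable] g[THEN smooth_supp_measurable]
  have a0: "a \<noteq> 0" using a by (rule P_nonzero)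
  obtain K where K: "K \<ge> 0" "\<And>x. norm (f x - f (refl_root a x)) \<le> K * \<bar>a \<bullet> x\<bar>"
    using f by (rule smooth_supp_reflection_bound) blast
  have [measurable]: "e f \<in> borel_measurable borel"
    unfolding e_def by measurable
  have bound: "norm (e f x) \<le> K * \<bar>half_coth (a \<bullet> x)\<bar>" for x
  proof -
    have "norm (e f x) \<le> \<bar>half_coth_deriv (a \<bullet> x)\<bar> * (K * \<bar>a \<bullet> x\<bar>)"
      unfolding e_def norm_mult using K by (auto intro: mult_left_mono)
    also have "\<dots> = K * \<bar>half_coth_deriv (a \<bullet> x) * (a \<bullet> x)\<bar>" by (simp add: abs_mult)
    also have "\<dots> \<le> K * \<bar>half_coth (a \<bullet> x)\<bar>"
      using K by (intro mult_left_mono abs_half_coth_deriv_mult_le)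
    finally show ?thesis .
  qed
  have int: "W_integrable (\<lambda>x. e f x * h x)" if h: "bounded_supp h" for h
  proof -
    note [measurable] = h[THEN bounded_supp_measurable]
    have "integrable lborel (\<lambda>x. of_real K * (of_real (half_coth (a \<bullet> x)) * h x * of_real (w x)))"
      using h a by (intro integrable_mult_right integrable_half_coth_weight)
    then show ?thesis
      unfolding W_integrable_def
    proof (rule Bochner_Integration.integrable_bound)
      show "AE x in lborel. norm (e f x * h x * of_real (w x))
          \<le> norm (of_real K * (of_real (half_coth (a \<bullet> x)) * h x * of_real (w x)))"
      proof (rule AE_I2)
        fix x
        have "norm (e f x) * (norm (h x) * w x) \<le> K * \<bar>half_coth (a \<bullet> x)\<bar> * (norm (h x) * w x)"
          using bound by (rule mult_right_mono) simp
        then show "norm (e f x * h x * of_real (w x))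
          \<le> norm (of_real K * (of_real (half_coth (a \<bullet> x)) * h x * of_real (w x)))"
          using K by (simp add: norm_mult mult.assoc)
      qed
    qed measurable
  qed
  have g': "bounded_supp g" "bounded_supp (\<lambda>x. g (refl_root a x))"
    using smooth_supp_bounded_supp[OF g] a0 by auto
  show "W_integrable (\<lambda>x. e f x * g x)"
    using g' by (intro int)
  have "W_integral (\<lambda>x. e f x * g x) = W_integral (\<lambda>x. e f x * (g x - g (refl_root a x))) / 2"
  proof (rule W_integral_odd[OF a])
    show "e f (refl_root a x) = - e f x" for x
      using a0 by (simp add: e_def refl_root_involution flip: refl_root_adjoint) (simp add: algebra_simps)
  qed (use g' in \<open>auto intro: int\<close>)
  then show "W_integral (\<lambda>x. e f x * g x) = W_integral (\<lambda>x. of_real (half_coth_deriv (a \<bullet> x)) *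
      ((f x - f (refl_root a x)) * (g x - g (refl_root a x)))) / 2"
    by (simp only: e_def mult.assoc)
qed

text \<open>Multiplication by \<open>half_coth\<close> is self-adjoint, but composing it with the reflection is skew, since
  \<open>half_coth\<close> is odd. Hence \<open>coth_diff b\<close> is skew up to multiplication by \<open>2 * half_coth\<close>.\<close>

lemma coth_diff_adjoint:
  assumes h: "bounded_supp h" and g: "smooth_supp g" and b: "b \<in> P"
  shows "W_integrable (\<lambda>x. coth_diff b h x * g x)"
    and "W_integral (\<lambda>x. coth_diff b h x * g x)
      = 2 * W_integral (\<lambda>x. of_real (half_coth (b \<bullet> x)) * (h x * g x)) - W_integral (\<lambda>x. h x * coth_diff b g x)"
proof -
  note [measurable] = h[THEN bounded_supp_measurable] g[THEN smooth_supp_measurable]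
  have b0: "b \<noteq> 0" using b by (rule P_nonzero)
  let ?c = "\<lambda>x. complex_of_real (half_coth (b \<bullet> x))"
  have g': "bounded_supp g" using g by (rule smooth_supp_bounded_supp)
  have int: "W_integrable (\<lambda>x. ?c x * (h x * g x))" "W_integrable (\<lambda>x. ?c x * (h (refl_root b x) * g x))"
    "W_integrable (\<lambda>x. ?c x * (h x * g (refl_root b x)))"
    using h g' b b0 by (auto intro!: W_integrable_half_coth)
  have eq: "(\<lambda>x. coth_diff b h x * g x) = (\<lambda>x. ?c x * (h x * g x) - ?c x * (h (refl_root b x) * g x))"
    "(\<lambda>x. h x * coth_diff b g x) = (\<lambda>x. ?c x * (h x * g x) - ?c x * (h x * g (refl_root b x)))"
    by (auto simp: coth_diff_def algebra_simps)
  show "W_integrable (\<lambda>x. coth_diff b h x * g x)"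
    unfolding eq by (intro W_integrable_diff int)
  have "W_integral (\<lambda>x. ?c x * (h (refl_root b x) * g x))
      = W_integral (\<lambda>x. ?c (refl_root b x) * (h (refl_root b (refl_root b x)) * g (refl_root b x)))"
    by (rule W_integral_refl_root[OF b, symmetric]) measurable
  also have "\<dots> = - W_integral (\<lambda>x. ?c x * (h x * g (refl_root b x)))"
    using W_integral_cmult[of "- 1" "\<lambda>x. ?c x * (h x * g (refl_root b x))"] b0
    by (simp add: refl_root_involution flip: refl_root_adjoint)
  finally show "W_integral (\<lambda>x. coth_diff b h x * g x)
      = 2 * W_integral (\<lambda>x. ?c x * (h x * g x)) - W_integral (\<lambda>x. h x * coth_diff b g x)"
    unfolding eq by (simp add: W_integral_diff int)
qed

text \<open>The reflection in \<open>a\<close> permutes the summands up to the sign of \<open>a \<bullet> b\<close>.\<close>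

lemma half_coth_sum_odd:
  assumes a: "a \<in> P"
  shows "(\<Sum>b\<in>P. k b * (a \<bullet> b) * half_coth (b \<bullet> refl_root a x)) = - (\<Sum>b\<in>P. k b * (a \<bullet> b) * half_coth (b \<bullet> x))"
proof -
  have "(\<Sum>b\<in>P. k b * (a \<bullet> b) * half_coth (b \<bullet> refl_root a x))
      = (\<Sum>b\<in>P. - (k (refl_root a b) * (a \<bullet> refl_root a b) * half_coth (refl_root a b \<bullet> x)))"
    using P_nonzero[OF a] a
    by (intro sum.cong) (simp_all add: k_refl P_R refl_root_adjoint flip: refl_root_adjoint[of a a])
  also have "\<dots> = (\<Sum>b\<in>P. - (k b * (a \<bullet> b) * half_coth (b \<bullet> x)))"
    by (rule sum_refl_root[OF a]) (simp add: k_uminus)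
  finally show ?thesis
    by (simp add: sum_negf)
qed

text \<open>The form is symmetric although \<open>coth_diff b\<close> is not skew: the multipliers left over from the adjoints of the
  \<open>coth_diff b\<close> add up to \<open>2 * m a\<close>, and \<open>m a\<close> is odd under the reflection in \<open>a\<close>, whereas
  \<open>coth_diff a f\<close> is even. Each integral makes sense on its own because \<open>coth_diff a f\<close> is bounded.\<close>

lemma coth_diff_form:
  assumes f: "smooth_supp f" and g: "smooth_supp g"
  defines "m \<equiv> \<lambda>a x. complex_of_real (\<Sum>b\<in>P. k b * (a \<bullet> b) * half_coth (b \<bullet> x))"
  shows "(\<Sum>a\<in>P. \<Sum>b\<in>P. of_real (k a * k b * (a \<bullet> b)) * W_integral (\<lambda>x. coth_diff b (coth_diff a f) x * g x))
    = (\<Sum>a\<in>P. of_real (k a) * W_integral (\<lambda>x. of_real (half_coth (a \<bullet> x)) * m a x *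
          ((f x - f (refl_root a x)) * (g x - g (refl_root a x)))))
    - (\<Sum>a\<in>P. \<Sum>b\<in>P. of_real (k a * k b * (a \<bullet> b)) * W_integral (\<lambda>x. coth_diff a f x * coth_diff b g x))"
proof -
  note [measurable] = f[THEN smooth_supp_measurable] g[THEN smooth_supp_measurable]
  have cf: "bounded_supp (coth_diff a f)" if "a \<in> P" for a
    using f P_nonzero[OF that] by (rule bounded_supp_coth_diff)
  have int: "W_integrable (\<lambda>x. of_real (half_coth (b \<bullet> x)) * (coth_diff a f x * h x))"
    if "a \<in> P" "b \<in> P" "bounded_supp h" for a b h
    using that cf by (intro W_integrable_half_coth) auto
  have m_eq: "m a x * coth_diff a f x * h x
      = (\<Sum>b\<in>P. of_real (k b * (a \<bullet> b)) * (of_real (half_coth (b \<bullet> x)) * (coth_diff a f x * h x)))" for a x h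
    by (simp add: m_def sum_distrib_right mult.assoc)
  have int_m: "W_integrable (\<lambda>x. m a x * coth_diff a f x * h x)" if "a \<in> P" "bounded_supp h" for a h
    unfolding m_eq using that by (intro W_integrable_sum W_integrable_cmult int)
  have defect: "(\<Sum>b\<in>P. of_real (k a * k b * (a \<bullet> b)) * (2 * W_integral (\<lambda>x. of_real (half_coth (b \<bullet> x)) * (coth_diff a f x * g x))))
     = of_real (k a) * W_integral (\<lambda>x. of_real (half_coth (a \<bullet> x)) * m a x *
          ((f x - f (refl_root a x)) * (g x - g (refl_root a x))))" if a: "a \<in> P" for a
  proof -
    have a0: "a \<noteq> 0" using a by (rule P_nonzero)
    have g': "bounded_supp g" "bounded_supp (\<lambda>x. g (refl_root a x))"
      using smooth_supp_bounded_supp[OF g] a0 by auto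
    have [measurable]: "m a \<in> borel_measurable borel"
      unfolding m_def by measurable
    have "(\<Sum>b\<in>P. of_real (k a * k b * (a \<bullet> b)) * (2 * W_integral (\<lambda>x. of_real (half_coth (b \<bullet> x)) * (coth_diff a f x * g x))))
      = 2 * of_real (k a) * W_integral (\<lambda>x. m a x * coth_diff a f x * g x)"
    proof -
      have "W_integral (\<lambda>x. m a x * coth_diff a f x * g x)
        = (\<Sum>b\<in>P. of_real (k b * (a \<bullet> b)) * W_integral (\<lambda>x. of_real (half_coth (b \<bullet> x)) * (coth_diff a f x * g x)))"
        unfolding m_eq W_integral_cmult[symmetric]
        by (rule W_integral_sum) (intro W_integrable_cmult int a g')
      then show ?thesis
        by (simp add: sum_distrib_left ac_simps)
    qed
    also have "W_integral (\<lambda>x. m a x * coth_diff a f x * g x)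
      = W_integral (\<lambda>x. m a x * coth_diff a f x * (g x - g (refl_root a x))) / 2"
      by (rule W_integral_odd[OF a])
         (use a a0 g' in \<open>auto simp: coth_diff_refl_root half_coth_sum_odd m_def simp del: of_real_sum intro: int_m[unfolded m_def]\<close>)
    also have "(\<lambda>x. m a x * coth_diff a f x * (g x - g (refl_root a x)))
      = (\<lambda>x. of_real (half_coth (a \<bullet> x)) * m a x * ((f x - f (refl_root a x)) * (g x - g (refl_root a x))))"
      by (simp add: coth_diff_def fun_eq_iff)
    finally show ?thesis by simp
  qed
  have "(\<Sum>a\<in>P. \<Sum>b\<in>P. of_real (k a * k b * (a \<bullet> b)) * W_integral (\<lambda>x. coth_diff b (coth_diff a f) x * g x))
    = (\<Sum>a\<in>P. (\<Sum>b\<in>P. of_real (k a * k b * (a \<bullet> b)) * (2 * W_integral (\<lambda>x. of_real (half_coth (b \<bullet> x)) * (coth_diff a f x * g x))))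
      - (\<Sum>b\<in>P. of_real (k a * k b * (a \<bullet> b)) * W_integral (\<lambda>x. coth_diff a f x * coth_diff b g x)))"
    unfolding sum_subtractf[symmetric] right_diff_distrib[symmetric]
    by (intro sum.cong refl) (simp only: coth_diff_adjoint(2)[OF cf g])
  then show ?thesis
    by (simp only: sum_subtractf defect cong: sum.cong)
qed

lemma explicit_laplacian_form:
  assumes f: "smooth_supp f" and g: "smooth_supp g" and B: "orthonormal_basis B"
  shows "W_integrable (\<lambda>x. explicit_laplacian B P k f x * g x)"
    and "W_integral (\<lambda>x. explicit_laplacian B P k f x * g x) =
      - (\<Sum>\<xi>\<in>B. W_integral (\<lambda>x. frechet_derivative f (at x) \<xi> * frechet_derivative g (at x) \<xi>))
      + (\<Sum>a\<in>P. of_real (k a * (a \<bullet> a)) * (W_integral (\<lambda>x. of_real (half_coth_deriv (a \<bullet> x)) *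
          ((f x - f (refl_root a x)) * (g x - g (refl_root a x)))) / 2))
      + ((\<Sum>a\<in>P. of_real (k a) * W_integral (\<lambda>x. of_real (half_coth (a \<bullet> x)) *
            of_real (\<Sum>b\<in>P. k b * (a \<bullet> b) * half_coth (b \<bullet> x)) *
            ((f x - f (refl_root a x)) * (g x - g (refl_root a x)))))
         - (\<Sum>a\<in>P. \<Sum>b\<in>P. of_real (k a * k b * (a \<bullet> b)) * W_integral (\<lambda>x. coth_diff a f x * coth_diff b g x)))
      + (\<Sum>a\<in>P. \<Sum>b\<in>P. of_real (k a * k b * (a \<bullet> b) / 4) * W_integral (\<lambda>x. f (refl_root a x) * g (refl_root b x)))"
proof -
  note [measurable] = f[THEN smooth_supp_measurable] g[THEN smooth_supp_measurable]
  have bs: "bounded_supp f" "bounded_supp g"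
    using f g by (auto intro: smooth_supp_bounded_supp)
  let ?F1 = "\<lambda>x. ((\<Sum>\<xi>\<in>B. frechet_derivative (\<lambda>y. frechet_derivative f (at y) \<xi>) (at x) \<xi>)
     + (\<Sum>a\<in>P. of_real (2 * k a * half_coth (a \<bullet> x)) * frechet_derivative f (at x) a)) * g x"
  let ?e2 = "\<lambda>a x. of_real (half_coth_deriv (a \<bullet> x)) * (f x - f (refl_root a x)) * g x"
  let ?F2 = "\<lambda>x. \<Sum>a\<in>P. of_real (k a * (a \<bullet> a)) * ?e2 a x"
  let ?e3 = "\<lambda>a b x. coth_diff b (coth_diff a f) x * g x"
  let ?F3 = "\<lambda>x. \<Sum>a\<in>P. \<Sum>b\<in>P. of_real (k a * k b * (a \<bullet> b)) * ?e3 a b x"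
  let ?e4 = "\<lambda>a b x. f (refl_root a (refl_root b x)) * g x"
  let ?F4 = "\<lambda>x. \<Sum>a\<in>P. \<Sum>b\<in>P. of_real (k a * k b * (a \<bullet> b) / 4) * ?e4 a b x"
  have eq: "(\<lambda>x. explicit_laplacian B P k f x * g x) = (\<lambda>x. ?F1 x + ?F2 x + ?F3 x + ?F4 x)"
  proof
    fix x
    have "explicit_laplacian B P k f x * g x = ?F1 x
      + (\<Sum>a\<in>P. of_real (k a * (a \<bullet> a) * half_coth_deriv (a \<bullet> x)) * (f x - f (refl_root a x))) * g x
      + (\<Sum>a\<in>P. \<Sum>b\<in>P. of_real (k a * k b * (a \<bullet> b)) *
         (coth_diff b (coth_diff a f) x + f (refl_root a (refl_root b x)) / 4)) * g x"
      unfolding explicit_laplacian_def by (simp only: distrib_right)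
    moreover have "(\<Sum>a\<in>P. of_real (k a * (a \<bullet> a) * half_coth_deriv (a \<bullet> x)) * (f x - f (refl_root a x))) * g x = ?F2 x"
      unfolding sum_distrib_right by (intro sum.cong) simp_all
    moreover have "(\<Sum>a\<in>P. \<Sum>b\<in>P. of_real (k a * k b * (a \<bullet> b)) *
         (coth_diff b (coth_diff a f) x + f (refl_root a (refl_root b x)) / 4)) * g x = ?F3 x + ?F4 x"
      unfolding sum_distrib_right sum.distrib[symmetric] by (intro sum.cong) (simp_all add: field_simps)
    ultimately show "explicit_laplacian B P k f x * g x = ?F1 x + ?F2 x + ?F3 x + ?F4 x"
      by (simp only: add.assoc)
  qed
  have e2: "W_integrable (?e2 a)" if "a \<in> P" for a
    using half_coth_deriv_form(1)[OF f g that] .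
  have e3: "W_integrable (?e3 a b)" if "a \<in> P" "b \<in> P" for a b
    using bounded_supp_coth_diff[OF f P_nonzero] g that by (intro coth_diff_adjoint(1)) auto
  have e4: "W_integrable (?e4 a b)" if "a \<in> P" "b \<in> P" for a b
    using that P_nonzero bs by (intro W_integrable_bounded_supp bounded_supp_times bounded_supp_refl_root[of _ b]
        bounded_supp_refl_root[of f]) auto
  have F1: "W_integrable ?F1"
    by (rule first_order_form(1)[OF f g B])
  have F2: "W_integrable ?F2"
    by (intro W_integrable_sum W_integrable_cmult e2)
  have F3: "W_integrable ?F3"
    by (intro W_integrable_sum W_integrable_cmult e3)
  have F4: "W_integrable ?F4"
    by (intro W_integrable_sum W_integrable_cmult e4)
  show "W_integrable (\<lambda>x. explicit_laplacian B P k f x * g x)"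
    unfolding eq by (intro W_integrable_add F1 F2 F3 F4)
  have I2: "W_integral ?F2 = (\<Sum>a\<in>P. of_real (k a * (a \<bullet> a)) * W_integral (?e2 a))"
    by (subst W_integral_sum) (auto simp: W_integral_cmult simp del: of_real_mult intro!: W_integrable_cmult e2)
  have I3: "W_integral ?F3 = (\<Sum>a\<in>P. \<Sum>b\<in>P. of_real (k a * k b * (a \<bullet> b)) * W_integral (?e3 a b))"
    by (subst W_integral_sum, intro W_integrable_sum W_integrable_cmult e3, assumption+, intro sum.cong refl,
        subst W_integral_sum, intro W_integrable_cmult e3, assumption+, simp only: W_integral_cmult)
  have I4: "W_integral ?F4 = (\<Sum>a\<in>P. \<Sum>b\<in>P. of_real (k a * k b * (a \<bullet> b) / 4) * W_integral (?e4 a b))"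
    by (subst W_integral_sum, intro W_integrable_sum W_integrable_cmult e4, assumption+, intro sum.cong refl,
        subst W_integral_sum, intro W_integrable_cmult e4, assumption+, simp only: W_integral_cmult)
  have e4': "W_integral (?e4 a b) = W_integral (\<lambda>x. f (refl_root a x) * g (refl_root b x))" if "b \<in> P" for a b
    using W_integral_refl_root[OF that, of "\<lambda>x. f (refl_root a x) * g (refl_root b x)"] P_nonzero[OF that]
    by (simp add: refl_root_involution)
  show "W_integral (\<lambda>x. explicit_laplacian B P k f x * g x) =
      - (\<Sum>\<xi>\<in>B. W_integral (\<lambda>x. frechet_derivative f (at x) \<xi> * frechet_derivative g (at x) \<xi>))
      + (\<Sum>a\<in>P. of_real (k a * (a \<bullet> a)) * (W_integral (\<lambda>x. of_real (half_coth_deriv (a \<bullet> x)) *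
          ((f x - f (refl_root a x)) * (g x - g (refl_root a x)))) / 2))
      + ((\<Sum>a\<in>P. of_real (k a) * W_integral (\<lambda>x. of_real (half_coth (a \<bullet> x)) *
            of_real (\<Sum>b\<in>P. k b * (a \<bullet> b) * half_coth (b \<bullet> x)) *
            ((f x - f (refl_root a x)) * (g x - g (refl_root a x)))))
         - (\<Sum>a\<in>P. \<Sum>b\<in>P. of_real (k a * k b * (a \<bullet> b)) * W_integral (\<lambda>x. coth_diff a f x * coth_diff b g x)))
      + (\<Sum>a\<in>P. \<Sum>b\<in>P. of_real (k a * k b * (a \<bullet> b) / 4) * W_integral (\<lambda>x. f (refl_root a x) * g (refl_root b x)))"
    unfolding eq
    by (simp only: W_integral_add[OF W_integrable_add[OF W_integrable_add[OF F1 F2] F3] F4]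
        W_integral_add[OF W_integrable_add[OF F1 F2] F3] W_integral_add[OF F1 F2]
        first_order_form(2)[OF f g B] I2 I3 I4 coth_diff_form[OF f g] half_coth_deriv_form(2)[OF f g] e4' cong: sum.cong)
qed

text \<open>Every term of the formula for the form is unchanged when \<open>f\<close> and \<open>g\<close> are exchanged, if in
  the double sums \<open>a\<close> and \<open>b\<close> are exchanged too.\<close>

lemma explicit_laplacian_symmetric:
  assumes f: "smooth_supp f" and g: "smooth_supp g" and B: "orthonormal_basis B"
  shows "W_integral (\<lambda>x. explicit_laplacian B P k f x * g x) = W_integral (\<lambda>x. explicit_laplacian B P k g x * f x)"
proof -
  have swap: "(\<Sum>a\<in>P. \<Sum>b\<in>P. of_real (c * (k a * k b * (a \<bullet> b))) * W_integral (\<lambda>x. p a x * q b x))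
    = (\<Sum>a\<in>P. \<Sum>b\<in>P. of_real (c * (k a * k b * (a \<bullet> b))) * W_integral (\<lambda>x. q a x * p b x))"
    for c and p q :: "'a \<Rightarrow> 'a \<Rightarrow> complex"
    by (subst sum.swap) (simp add: ac_simps inner_commute)
  show ?thesis
    unfolding explicit_laplacian_form(2)[OF f g B] explicit_laplacian_form(2)[OF g f B]
    using swap[of 1 "\<lambda>a. coth_diff a f" "\<lambda>b. coth_diff b g"]
      swap[of "1/4" "\<lambda>a x. f (refl_root a x)" "\<lambda>b x. g (refl_root b x)"]
    by (simp add: mult.commute)
qed

lemma explicit_laplacian_cnj:
  assumes f: "smooth f"
  shows "explicit_laplacian B P k (\<lambda>x. cnj (f x)) x = cnj (explicit_laplacian B P k f x)"
  unfolding explicit_laplacian_def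
  using smooth_differentiable[OF f] smooth_differentiable[OF smooth_frechet_derivative[OF f]]
  by (simp add: frechet_derivative_cnj coth_diff_def)

text \<open>Measurability has to be assumed because on the hyperplanes, a null set, the values of the Laplacian
  are not controlled by the explicit formula, and a function that agrees almost everywhere with a Borel function need not be Borel.\<close>

lemma dunkl_laplacian_symmetric:
  assumes f: "smooth_supp f" and g: "smooth_supp g" and B: "orthonormal_basis B"
    and [measurable]: "dunkl_laplacian B P k f \<in> borel_measurable borel"
      "dunkl_laplacian B P k g \<in> borel_measurable borel"
  shows "W_integral (\<lambda>x. dunkl_laplacian B P k f x * cnj (g x))
    = W_integral (\<lambda>x. f x * cnj (dunkl_laplacian B P k g x))"
proof -
  note [measurable] = f[THEN smooth_supp_measurable] g[THEN smooth_supp_measurable]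
  have [measurable]: "cnj \<in> borel_measurable borel"
    by (intro borel_measurable_continuous_onI continuous_intros)
  let ?L = "explicit_laplacian B P k"
  have cg: "smooth_supp (\<lambda>x. cnj (g x))" using g by (rule smooth_supp_cnj)
  have "W_integral (\<lambda>x. dunkl_laplacian B P k f x * cnj (g x)) = W_integral (\<lambda>x. ?L f x * cnj (g x))"
    unfolding W_integral_def
  proof (rule integral_cong_AE)
    show "(\<lambda>x. ?L f x * cnj (g x) * of_real (w x)) \<in> borel_measurable lborel"
      using explicit_laplacian_form(1)[OF f cg B] unfolding W_integrable_def
      by (rule borel_measurable_integrable)
    show "AE x in lborel. dunkl_laplacian B P k f x * cnj (g x) * of_real (w x) = ?L f x * cnj (g x) * of_real (w x)"
      using AE_regular by eventually_elim (simp add: dunkl_laplacian_regular[OF B smooth_supp_smooth[OF f]])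
  qed measurable
  also have "\<dots> = W_integral (\<lambda>x. ?L (\<lambda>x. cnj (g x)) x * f x)"
    by (rule explicit_laplacian_symmetric[OF f cg B])
  also have "\<dots> = W_integral (\<lambda>x. f x * cnj (dunkl_laplacian B P k g x))"
    unfolding W_integral_def
  proof (rule integral_cong_AE)
    show "(\<lambda>x. ?L (\<lambda>x. cnj (g x)) x * f x * of_real (w x)) \<in> borel_measurable lborel"
      using explicit_laplacian_form(1)[OF cg f B] unfolding W_integrable_def
      by (rule borel_measurable_integrable)
    show "AE x in lborel. ?L (\<lambda>x. cnj (g x)) x * f x * of_real (w x)
        = f x * cnj (dunkl_laplacian B P k g x) * of_real (w x)"
      using AE_regular by eventually_elim
        (simp add: dunkl_laplacian_regular[OF B smooth_supp_smooth[OF g]]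
          explicit_laplacian_cnj[OF smooth_supp_smooth[OF g]])
  qed measurable
  finally show ?thesis .
qed

end


section \<open>Time derivatives\<close>

definition dt :: "(real \<times> 'a::euclidean_space \<Rightarrow> complex) \<Rightarrow> real \<times> 'a \<Rightarrow> complex" where
  "dt F p = frechet_derivative F (at p) (1, 0)"

lemma smooth_dt: "smooth F \<Longrightarrow> smooth (dt F)"
  unfolding dt_def[abs_def] by (rule smooth_frechet_derivative)

lemma has_vector_derivative_dt:
  assumes "smooth F"
  shows "((\<lambda>t. F (t, x)) has_vector_derivative dt F (t, x)) (at t)"
  using frechet_line_has_vector_derivative[where x="(0, x)" and v="(1, 0)" and \<tau>=t,
      OF smooth_differentiable[OF assms]]
  by (simp add: dt_def)

lemma time_deriv_dt:
  "smooth F \<Longrightarrow> time_deriv (\<lambda>t x. F (t, x)) = (\<lambda>t x. dt F (t, x))"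
  unfolding time_deriv_def by (intro ext vector_derivative_at has_vector_derivative_dt)

lemma dt_eq_0_outside_cone:
  fixes F :: "real \<times> 'a::euclidean_space \<Rightarrow> complex"
  assumes supp: "\<And>t x. r + \<bar>t\<bar> < norm x \<Longrightarrow> F (t, x) = 0" and tx: "r + \<bar>t\<bar> < norm x"
  shows "dt F (t, x) = 0"
proof -
  let ?S = "{p :: real \<times> 'a. r + \<bar>fst p\<bar> < norm (snd p)}"
  have "open ?S"
    by (intro open_Collect_less continuous_intros)
  then have "(F has_derivative (\<lambda>h. 0)) (at (t, x))"
    by (rule has_derivative_transform_within_open[OF has_derivative_const[of 0]]) (use assms in auto)
  then show ?thesis
    by (simp add: dt_def frechet_derivative_at[symmetric])
qed

lemma slice_has_derivative:
  assumes "F differentiable (at (t, x))"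
  shows "((\<lambda>x. F (t, x)) has_derivative (\<lambda>v. frechet_derivative F (at (t, x)) (0, v))) (at x)"
proof -
  have "((\<lambda>x. (t, x)) has_derivative (\<lambda>v. (0, v))) (at x)"
    by (auto intro!: derivative_eq_intros)
  moreover have "(F has_derivative frechet_derivative F (at (t, x))) (at (t, x))"
    using assms by (simp add: frechet_derivative_works)
  ultimately show ?thesis
    by (rule has_derivative_compose)
qed

lemma continuously_differentiable_slice:
  "continuously_differentiable n F \<Longrightarrow> continuously_differentiable n (\<lambda>x. F (t, x))"
proof (induction n arbitrary: F)
  case 0
  then show ?case
    by (auto intro!: continuous_intros continuous_on_compose2[where s=UNIV and f="\<lambda>x. (t, x)" and t=UNIV and g=F])
next
  case (Suc n)
  have "F differentiable (at p)" for p
    using Suc.prems unfolding continuously_differentiable.simps by blast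
  note D = slice_has_derivative[OF this]
  have "frechet_derivative (\<lambda>x. F (t, x)) (at x) v = frechet_derivative F (at (t, x)) (0, v)" for x v
    using D[of t x] by (simp add: frechet_derivative_at[symmetric])
  moreover have "(\<lambda>x. F (t, x)) differentiable (at x)" for x
    using D by (auto simp: differentiable_def)
  ultimately show ?case
    using Suc.prems by (auto intro: Suc.IH)
qed

lemma smooth_slice: "smooth F \<Longrightarrow> smooth (\<lambda>x. F (t, x))"
  by (simp add: smooth_def continuously_differentiable_slice)

context positive_roots begin

text \<open>For times within distance 1 of \<open>t\<close>, all supports lie in one box, where the
  Leibniz rule for continuous integrands applies.\<close>

lemma W_integral_has_vector_derivative:
  fixes \<psi> \<psi>' :: "real \<times> 'a \<Rightarrow> complex"
  assumes cont: "continuous_on UNIV \<psi>" "continuous_on UNIV \<psi>'"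
    and deriv: "\<And>t x. ((\<lambda>t. \<psi> (t, x)) has_vector_derivative \<psi>' (t, x)) (at t)"
    and supp: "\<And>t x. r + \<bar>t\<bar> < norm x \<Longrightarrow> \<psi> (t, x) = 0" "\<And>t x. r + \<bar>t\<bar> < norm x \<Longrightarrow> \<psi>' (t, x) = 0"
  shows "((\<lambda>t. W_integral (\<lambda>x. \<psi> (t, x))) has_vector_derivative W_integral (\<lambda>x. \<psi>' (t, x))) (at t)"
proof -
  obtain c where c: "cball (0::'a) (r + \<bar>t\<bar> + 1) \<subseteq> cbox (- c) c"
    using bounded_subset_cbox_symmetric[OF bounded_cball] by blast
  let ?U = "{t - 1<..<t + 1}"
  have slice: "continuous_on S (\<lambda>x. \<phi> (s, x))" if "continuous_on UNIV \<phi>" for \<phi> :: "real \<times> 'a \<Rightarrow> complex" and s S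
    using that by (rule continuous_on_compose2) (auto intro!: continuous_intros)
  have W: "W_integral (\<lambda>x. \<phi> (s, x)) = integral (cbox (- c) c) (\<lambda>x. \<phi> (s, x) * of_real (w x))"
    if \<phi>: "continuous_on UNIV \<phi>" and supp\<phi>: "\<And>t x. r + \<bar>t\<bar> < norm x \<Longrightarrow> \<phi> (t, x) = 0" and s: "s \<in> ?U"
    for \<phi> s
  proof -
    have "bounded_supp (\<lambda>x. \<phi> (s, x))"
      using slice[OF \<phi>] supp\<phi> by (rule bounded_supp_continuous)
    then have "W_integral (\<lambda>x. \<phi> (s, x)) = integral UNIV (\<lambda>x. \<phi> (s, x) * of_real (w x))"
      unfolding W_integral_def by (intro integral_lborel[symmetric] integrable_weight)
    also have "(\<lambda>x. \<phi> (s, x) * of_real (w x))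
      = (\<lambda>x. if x \<in> cbox (- c) c then \<phi> (s, x) * of_real (w x) else 0)"
    proof
      fix x
      show "\<phi> (s, x) * of_real (w x) = (if x \<in> cbox (- c) c then \<phi> (s, x) * of_real (w x) else 0)"
      proof (cases "x \<in> cbox (- c) c")
        case False
        then have "x \<notin> cball 0 (r + \<bar>t\<bar> + 1)" using c by blast
        then have "r + \<bar>s\<bar> < norm x" using s by auto
        then show ?thesis by (simp add: supp\<phi>)
      qed simp
    qed
    also have "integral UNIV \<dots> = integral (cbox (- c) c) (\<lambda>x. \<phi> (s, x) * of_real (w x))"
      by (rule integral_restrict_UNIV)
    finally show ?thesis .
  qed
  have "((\<lambda>s. integral (cbox (- c) c) (\<lambda>x. \<psi> (s, x) * of_real (w x))) has_vector_derivative
      integral (cbox (- c) c) (\<lambda>x. \<psi>' (t, x) * of_real (w x))) (at t within ?U)"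
  proof (rule leibniz_rule_vector_derivative[where f="\<lambda>s x. \<psi> (s, x) * of_real (w x)"
        and fx="\<lambda>s x. \<psi>' (s, x) * of_real (w x)"])
    show "((\<lambda>s. \<psi> (s, x) * of_real (w x)) has_vector_derivative \<psi>' (s, x) * of_real (w x)) (at s within ?U)" for s x
      by (intro has_vector_derivative_mult_left has_vector_derivative_at_within[OF deriv])
    show "(\<lambda>x. \<psi> (s, x) * of_real (w x)) integrable_on cbox (- c) c" for s
      by (intro integrable_continuous continuous_intros slice cont continuous_on_weight)
    show "continuous_on (?U \<times> cbox (- c) c) (\<lambda>(s, x). \<psi>' (s, x) * of_real (w x))"
      unfolding case_prod_unfold prod.collapse
      by (intro continuous_intros continuous_on_subset[OF cont(2)]
          continuous_on_compose2[OF continuous_on_weight[of UNIV]]) auto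
  qed auto
  then have "((\<lambda>s. integral (cbox (- c) c) (\<lambda>x. \<psi> (s, x) * of_real (w x))) has_vector_derivative
      W_integral (\<lambda>x. \<psi>' (t, x))) (at t)"
    using W[OF cont(2) supp(2), of t] at_within_open[of t ?U] by simp
  then show ?thesis
    by (rule has_vector_derivative_transform_within_open[where S="?U"])
       (use W[OF cont(1) supp(1)] in auto)
qed

lemma cnj_W_integral: "cnj (W_integral F) = W_integral (\<lambda>x. cnj (F x))"
  using Bochner_Integration.integral_cnj[of lborel "\<lambda>x. F x * of_real (w x)"] by (simp add: W_integral_def)

text \<open>By the wave equation the Laplacian of \<open>U\<close> is its second time derivative, hence smooth; therefore
  the energy can be differentiated under the integral, and symmetry is used only through its consequence
  \<open>key\<close>.\<close>

lemma energy_constant: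
  fixes U :: "real \<times> 'a \<Rightarrow> complex"
  assumes B: "orthonormal_basis B" and U: "smooth U"
    and supp: "\<And>t x. r + \<bar>t\<bar> < norm x \<Longrightarrow> U (t, x) = 0"
    and wave: "\<And>t x. dt (dt U) (t, x) = dunkl_laplacian B P k (\<lambda>x. U (t, x)) x"
  defines "E \<equiv> \<lambda>t. (W_integral (\<lambda>x. dt U (t, x) * cnj (dt U (t, x)))
    - W_integral (\<lambda>x. dt (dt U) (t, x) * cnj (U (t, x)))) / 2"
  shows "E s = E t"
proof -
  let ?V = "dt U" let ?A = "dt (dt U)" let ?J = "dt (dt (dt U))"
  have sm: "smooth U" "smooth ?V" "smooth ?A" "smooth ?J"
    using U by (auto intro: smooth_dt)
  have cont: "continuous_on S U" "continuous_on S ?V" "continuous_on S ?A" "continuous_on S ?J" for S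
    using sm by (auto intro: smooth_continuous_on)
  have slice: "continuous_on S (\<lambda>p. \<phi> (s, snd p))" if "\<And>S. continuous_on S \<phi>"
    for \<phi> :: "real \<times> 'a \<Rightarrow> complex" and s and S :: "(real \<times> 'a) set"
    by (rule continuous_on_compose2[OF that[of UNIV]]) (auto intro!: continuous_intros)
  have suppV: "?V (t, x) = 0" if "r + \<bar>t\<bar> < norm x" for t x
    by (rule dt_eq_0_outside_cone[OF _ that]) (rule supp)
  have suppA: "?A (t, x) = 0" if "r + \<bar>t\<bar> < norm x" for t x
    by (rule dt_eq_0_outside_cone[OF _ that]) (rule suppV)
  have suppJ: "?J (t, x) = 0" if "r + \<bar>t\<bar> < norm x" for t x
    by (rule dt_eq_0_outside_cone[OF _ that]) (rule suppA)
  note d = has_vector_derivative_dt[OF sm(1)] has_vector_derivative_dt[OF sm(2)] has_vector_derivative_dt[OF sm(3)]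
  note dc = d[THEN has_vector_derivative_cnj]
  have lap: "dunkl_laplacian B P k (\<lambda>x. U (t, x)) = (\<lambda>x. ?A (t, x))" for t
    by (simp add: wave fun_eq_iff)
  have "continuous_on UNIV (\<lambda>x. ?A (t, x))" for t
    using smooth_slice[OF sm(3)] by (rule smooth_continuous_on)
  then have meas: "(\<lambda>x. ?A (t, x)) \<in> borel_measurable borel" for t
    by (rule borel_measurable_continuous_onI)
  have smU: "smooth_supp (\<lambda>x. U (t, x))" for t
    unfolding smooth_supp_def using smooth_slice[OF U] supp by blast
  have sym: "W_integral (\<lambda>x. ?A (t, x) * cnj (U (s, x))) = W_integral (\<lambda>x. U (t, x) * cnj (?A (s, x)))" for s t
    using dunkl_laplacian_symmetric[OF smU smU B, of t s] meas by (simp add: lap)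
  \<comment> \<open>Differentiate the symmetry relation in \<open>s\<close> at \<open>s = t\<close>.\<close>
  have key: "W_integral (\<lambda>x. ?A (t, x) * cnj (?V (t, x))) = W_integral (\<lambda>x. U (t, x) * cnj (?J (t, x)))" for t
  proof (rule vector_derivative_unique_at)
    show "((\<lambda>s. W_integral (\<lambda>x. ?A (t, x) * cnj (U (s, x)))) has_vector_derivative
        W_integral (\<lambda>x. ?A (t, x) * cnj (?V (t, x)))) (at t)"
      using W_integral_has_vector_derivative[where r=r and \<psi>="\<lambda>p. ?A (t, snd p) * cnj (U p)"
          and \<psi>'="\<lambda>p. ?A (t, snd p) * cnj (?V p)" and t=t]
      by (simp add: supp suppV continuous_intros cont slice has_vector_derivative_mult_right dc)
    have "((\<lambda>s. W_integral (\<lambda>x. U (t, x) * cnj (?A (s, x)))) has_vector_derivative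
        W_integral (\<lambda>x. U (t, x) * cnj (?J (t, x)))) (at t)"
      using W_integral_has_vector_derivative[where r=r and \<psi>="\<lambda>p. U (t, snd p) * cnj (?A p)"
          and \<psi>'="\<lambda>p. U (t, snd p) * cnj (?J p)" and t=t]
      by (simp add: suppA suppJ continuous_intros cont slice has_vector_derivative_mult_right dc)
    then show "((\<lambda>s. W_integral (\<lambda>x. ?A (t, x) * cnj (U (s, x)))) has_vector_derivative
        W_integral (\<lambda>x. U (t, x) * cnj (?J (t, x)))) (at t)"
      by (simp only: sym)
  qed
  have int: "W_integrable (\<lambda>x. \<phi> (t, x) * cnj (\<theta> (t, x)))"
    if "smooth \<phi>" "smooth \<theta>" "\<And>t x. r + \<bar>t\<bar> < norm x \<Longrightarrow> \<phi> (t, x) = 0" for \<phi> \<theta> t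
  proof (rule W_integrable_bounded_supp[OF bounded_supp_continuous])
    show "continuous_on UNIV (\<lambda>x. \<phi> (t, x) * cnj (\<theta> (t, x)))"
      using that by (intro continuous_intros smooth_continuous_on smooth_slice)
    show "\<phi> (t, x) * cnj (\<theta> (t, x)) = 0" if "r + \<bar>t\<bar> < norm x" for x
      using that \<open>\<And>t x. r + \<bar>t\<bar> < norm x \<Longrightarrow> \<phi> (t, x) = 0\<close> by simp
  qed
  have "(E has_vector_derivative 0) (at t)" for t
  proof -
    let ?X = "W_integral (\<lambda>x. ?A (t, x) * cnj (?V (t, x)))"
    have VA: "W_integral (\<lambda>x. ?V (t, x) * cnj (?A (t, x))) = cnj ?X"
      by (simp add: cnj_W_integral mult.commute)
    have JU: "W_integral (\<lambda>x. ?J (t, x) * cnj (U (t, x))) = cnj ?X"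
      unfolding key cnj_W_integral by (simp add: mult.commute)
    have "((\<lambda>t. W_integral (\<lambda>x. ?V (t, x) * cnj (?V (t, x)))) has_vector_derivative
        W_integral (\<lambda>x. ?V (t, x) * cnj (?A (t, x)) + ?A (t, x) * cnj (?V (t, x)))) (at t)"
      using W_integral_has_vector_derivative[where r=r and \<psi>="\<lambda>p. ?V p * cnj (?V p)"
          and \<psi>'="\<lambda>p. ?V p * cnj (?A p) + ?A p * cnj (?V p)" and t=t]
      by (simp add: suppV suppA continuous_intros cont has_vector_derivative_mult[OF d(2) dc(2)])
    also have "W_integral (\<lambda>x. ?V (t, x) * cnj (?A (t, x)) + ?A (t, x) * cnj (?V (t, x))) = cnj ?X + ?X"
      by (subst W_integral_add) (auto intro!: int sm suppV suppA simp: VA)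
    finally have K: "((\<lambda>t. W_integral (\<lambda>x. ?V (t, x) * cnj (?V (t, x)))) has_vector_derivative cnj ?X + ?X) (at t)" .
    have "((\<lambda>t. W_integral (\<lambda>x. ?A (t, x) * cnj (U (t, x)))) has_vector_derivative
        W_integral (\<lambda>x. ?A (t, x) * cnj (?V (t, x)) + ?J (t, x) * cnj (U (t, x)))) (at t)"
      using W_integral_has_vector_derivative[where r=r and \<psi>="\<lambda>p. ?A p * cnj (U p)"
          and \<psi>'="\<lambda>p. ?A p * cnj (?V p) + ?J p * cnj (U p)" and t=t]
      by (simp add: suppA suppJ continuous_intros cont has_vector_derivative_mult[OF d(3) dc(1)])
    also have "W_integral (\<lambda>x. ?A (t, x) * cnj (?V (t, x)) + ?J (t, x) * cnj (U (t, x))) = ?X + cnj ?X"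
      by (subst W_integral_add) (auto intro!: int sm suppA suppJ simp: JU)
    finally have "((\<lambda>t. W_integral (\<lambda>x. ?A (t, x) * cnj (U (t, x)))) has_vector_derivative ?X + cnj ?X) (at t)" .
    from has_vector_derivative_divide[OF has_vector_derivative_diff[OF K this], of 2] show ?thesis
      by (simp add: E_def)
  qed
  then obtain c where "E t = c" for t
    using has_vector_derivative_zero_constant[of UNIV E] by auto
  then show ?thesis by simp
qed

end

section \<open>Conservation of energy\<close>

lemma dunkl_laplacian_restrict:
  assumes "finite P"
  shows "dunkl_laplacian B {a \<in> P. k a \<noteq> 0} k = dunkl_laplacian B P k"
proof -
  have r: "rho {a \<in> P. k a \<noteq> 0} k = rho P k"
    unfolding rho_def using assms by (intro arg_cong[where f="scaleR _"] sum.mono_neutral_left) auto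
  have "dunkl_cherednik {a \<in> P. k a \<noteq> 0} k = dunkl_cherednik P k"
    unfolding dunkl_cherednik_def[abs_def] r using assms
    by (intro ext arg_cong[where f="\<lambda>s. _ + s"] sum.mono_neutral_left) auto
  then show ?thesis
    by (simp add: dunkl_laplacian_def[abs_def])
qed

text \<open>Off the hyperplanes a root of multiplicity 0 contributes the factor \<open>_ powr 0 = 1\<close>; on its
  hyperplane the factor would be \<open>0 powr 0 = 0\<close>.\<close>

lemma weight_restrict:
  assumes "finite P" "\<forall>a\<in>P. a \<bullet> x \<noteq> 0"
  shows "weight {a \<in> P. k a \<noteq> 0} k x = weight P k x"
  unfolding weight_def using assms by (intro prod.mono_neutral_left) auto

lemma positive_roots_restrict:
  assumes R: "crystallographic_root_system R" and P: "positive_subsystem R P"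
    and k: "multiplicity_function R k"
  shows "positive_roots {a \<in> R. k a \<noteq> 0} {a \<in> P. k a \<noteq> 0} k"
proof
  have refl: "refl_root a b \<in> R" if "a \<in> R" "b \<in> R" for a b
    using R that unfolding crystallographic_root_system_def by blast
  have k_refl: "k (refl_root a b) = k b" if "a \<in> R" "b \<in> R" for a b
  proof -
    have "refl_root a \<circ> id \<in> weyl_group R"
      using that by (intro weyl_refl weyl_id)
    then show ?thesis
      using k that unfolding multiplicity_function_def by fastforce
  qed
  show "finite {a \<in> R. k a \<noteq> 0}" "0 \<notin> {a \<in> R. k a \<noteq> 0}"
    using R by (auto simp: crystallographic_root_system_def)
  show "0 < k a" if "a \<in> {a \<in> R. k a \<noteq> 0}" for a
    using k that by (force simp: multiplicity_function_def)
  show "refl_root a b \<in> {a \<in> R. k a \<noteq> 0}" "k (refl_root a b) = k b"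
    if "a \<in> {a \<in> R. k a \<noteq> 0}" "b \<in> {a \<in> R. k a \<noteq> 0}" for a b
    using that refl k_refl by auto
  show "positive_subsystem {a \<in> R. k a \<noteq> 0} {a \<in> P. k a \<noteq> 0}"
    using P unfolding positive_subsystem_def by blast
qed

lemma test_function_bounded_support:
  assumes "test_function f"
  obtains r where "\<And>x. r < norm x \<Longrightarrow> f x = 0"
proof -
  have "bounded {x. f x \<noteq> 0}"
    using assms bounded_subset[OF compact_imp_bounded closure_subset] by (auto simp: test_function_def)
  then obtain r where "\<forall>x\<in>{x. f x \<noteq> 0}. norm x \<le> r"
    unfolding bounded_iff by blast
  then show ?thesis
    by (intro that[of r]) force
qed

theorem mainTheorem1:
  fixes R P B :: "'a::euclidean_space set"
    and k :: "'a \<Rightarrow> real"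
    and f g :: "'a \<Rightarrow> complex"
    and u :: "real \<Rightarrow> 'a \<Rightarrow> complex"
  assumes "crystallographic_root_system R"
    and "positive_subsystem R P"
    and "multiplicity_function R k"
    and "orthonormal_basis B"
    and "test_function f"
    and "test_function g"
    and "wave_solution B P k f g u"
  shows "\<forall>s t. total_energy B P k u s = total_energy B P k u t"
proof -
  let ?P = "{a \<in> P. k a \<noteq> 0}"
  interpret positive_roots "{a \<in> R. k a \<noteq> 0}" ?P k
    using assms(1-3) by (rule positive_roots_restrict)
  have P: "finite P" "0 \<notin> P"
    using assms(1,2) by (auto simp: crystallographic_root_system_def positive_subsystem_def)
  let ?U = "\<lambda>(t, x). u t x"
  have U: "smooth ?U"
    using assms(7) by (simp add: wave_solution_def)
  have V: "time_deriv u = (\<lambda>t x. dt ?U (t, x))"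
    using time_deriv_dt[OF U] by simp
  have A: "time_deriv (time_deriv u) = (\<lambda>t x. dt (dt ?U) (t, x))"
    unfolding V by (rule time_deriv_dt[OF smooth_dt[OF U]])
  have wave: "dt (dt ?U) (t, x) = dunkl_laplacian B P k (u t) x" for t x
    using assms(7) unfolding wave_solution_def A by blast
  obtain r1 where r1: "\<And>x. r1 < norm x \<Longrightarrow> f x = 0"
    using assms(5) by (rule test_function_bounded_support) blast
  obtain r2 where r2: "\<And>x. r2 < norm x \<Longrightarrow> g x = 0"
    using assms(6) by (rule test_function_bounded_support) blast
  let ?r = "max 0 (max r1 r2)"
  have "\<forall>x. ?r < norm x \<longrightarrow> f x = 0 \<and> g x = 0"
    using r1 r2 by simp
  moreover have "?r \<ge> 0" by simp
  ultimately have supp: "u t x = 0" if "?r + \<bar>t\<bar> < norm x" for t x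
    using assms(7) that unfolding wave_solution_def by blast
  have [measurable]: "(\<lambda>x. dt ?U (t, x)) \<in> borel_measurable borel" "(\<lambda>x. dt (dt ?U) (t, x)) \<in> borel_measurable borel"
    "u t \<in> borel_measurable borel" for t
    using smooth_slice[OF U, of t] smooth_slice[OF smooth_dt[OF U], of t] smooth_slice[OF smooth_dt[OF smooth_dt[OF U]], of t]
    by (auto intro!: borel_measurable_continuous_onI intro: smooth_continuous_on)
  have [measurable]: "cnj \<in> borel_measurable borel" "(sinh::real\<Rightarrow>real) \<in> borel_measurable borel"
    by (intro borel_measurable_continuous_onI continuous_intros)+
  have [measurable]: "weight P k \<in> borel_measurable borel"
    unfolding weight_def[abs_def] by measurable
  have W: "(\<integral>x. F x * of_real (weight P k x) \<partial>lborel) = W_integral F"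
    if [measurable]: "F \<in> borel_measurable borel" for F :: "'a \<Rightarrow> complex"
    unfolding W_integral_def
  proof (rule integral_cong_AE)
    show "AE x in lborel. F x * of_real (weight P k x) = F x * of_real (w x)"
      using AE_off_hyperplanes[OF P] by eventually_elim (simp add: weight_restrict P)
  qed measurable
  have energy: "total_energy B P k u t = (W_integral (\<lambda>x. dt ?U (t, x) * cnj (dt ?U (t, x)))
    - W_integral (\<lambda>x. dt (dt ?U) (t, x) * cnj (?U (t, x)))) / 2" for t
  proof -
    have "complex_of_real (kinetic_energy P k u t)
        = 1 / 2 * (\<integral>x. complex_of_real ((cmod (dt ?U (t, x)))\<^sup>2 * weight P k x) \<partial>lborel)"
      unfolding kinetic_energy_def V integral_complex_of_real by simp
    also have "\<dots> = 1 / 2 * (\<integral>x. (dt ?U (t, x) * cnj (dt ?U (t, x))) * of_real (weight P k x) \<partial>lborel)"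
      by (simp add: complex_norm_square del: of_real_power)
    also have "\<dots> = 1 / 2 * W_integral (\<lambda>x. dt ?U (t, x) * cnj (dt ?U (t, x)))"
      by (subst W) auto
    finally have K: "complex_of_real (kinetic_energy P k u t) = 1 / 2 * W_integral (\<lambda>x. dt ?U (t, x) * cnj (dt ?U (t, x)))" .
    have "potential_energy B P k u t = - (1 / 2) * W_integral (\<lambda>x. dt (dt ?U) (t, x) * cnj (u t x))"
      unfolding potential_energy_def wave[symmetric] by (subst W) auto
    with K show ?thesis
      by (simp add: total_energy_def diff_divide_distrib)
  qed
  have wave': "dt (dt ?U) (t, x) = dunkl_laplacian B ?P k (\<lambda>x. ?U (t, x)) x" for t x
    using wave by (simp add: dunkl_laplacian_restrict P)
  show ?thesis
    unfolding energy
  proof (intro allI, rule energy_constant[OF assms(4) U _ wave'])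
    show "?r + \<bar>t\<bar> < norm x \<Longrightarrow> ?U (t, x) = 0" for t x
      using supp by simp
  qed
qed

end
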